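(* Let $(M,\tau)$ be a tracial von Neumann algebra and let $X_1,\dots,X_n\in M$ be self-adjoint elements with $M=W^*(X_1,\dots,X_n)$. Then $\Phi^*(X_1,\dots,X_n)<+\infty$ if and only if there exist (not necessarily bounded) anti-symmetric operators $Y_1,\dots,Y_n:L^2(M)\to L^2(M)$, whose domains include $\mathbb{C}(X_1,\dots,X_n)$, and which satisfy $[Y_j,X_i]=\delta_{ji}P_1$ for all $i,j=1,\dots,n$.
   Context: A tracial von Neumann algebra $(M,\tau)$ is a von Neumann algebra with a faithful normal tracial state. $L^2(M)$ is the GNS Hilbert space of $\tau$, on which $M$ acts by left multiplication, with trace vector $1$. $\mathbb{C}(X_1,\dots,X_n)\subset M$ is the unital algebra of all non-commutative polynomials in $X_1,\dots,X_n$, viewed via $Q\mapsto Q\cdot 1$ also as a dense subspace of $L^2(M)$. $P_1$ is the orthogonal projection of $L^2(M)$ onto $\mathbb{C}1$; $HS$ is the space of Hilbert--Schmidt operators on $L^2(M)$ with inner product $\langle S,T\rangle_{HS}=Tr(T^*S)$. $\partial_j$ is the $HS$-valued derivation with $\partial_j(X_i)=\delta_{ij}P_1$; on a formal monomial, $\partial_j(X_{i_1}\cdots X_{i_k})=\sum_{l:\,i_l=j}X_{i_1}\cdots X_{i_{l-1}}P_1X_{i_{l+1}}\cdots X_{i_k}$. "$\partial_j^*(P_1)$ exists" means there is $\xi_j\in L^2(M)$ (denoted $\partial_j^*(P_1)$) with $\langle\xi_j,p(X_1,\dots,X_n)1\rangle=\langle P_1,\partial_j(p)\rangle_{HS}$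 for all non-commutative polynomials $p$. The free Fisher information is $\Phi^*(X_1,\dots,X_n)=\sum_{j=1}^n\|\partial_j^*(P_1)\|_2^2$ if $\partial_j^*(P_1)$ exists for all $j$, and $+\infty$ otherwise. A densely defined operator $Y$ is anti-symmetric if $\langle Y\zeta,\eta\rangle=-\langle\zeta,Y\eta\rangle$ for all $\zeta,\eta$ in its domain. The equation $[Y_j,X_i]=\delta_{ji}P_1$ means $Y_jX_i\zeta-X_iY_j\zeta=\delta_{ji}P_1\zeta$ for all $\zeta\in\mathbb{C}(X_1,\dots,X_n)\cdot 1$. *)

theory Defs
  imports "HOL-Analysis.Analysis" "HOL-Library.Poly_Mapping"
begin

section \<open>Complex Hilbert spaces\<close>

text \<open>A complex Hilbert space is a complete real inner product space together with a compatible
  complex scalar multiplication and a complex inner product, linear in the \<^emph>\<open>first\<close> argument, whose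
  real part is the real inner product. Norm and topology are those of the real structure.\<close>

class chilbert_space = real_inner + complete_space +
  fixes scaleC :: "complex \<Rightarrow> 'a \<Rightarrow> 'a"  (infixr "*\<^sub>C" 75)
    and cinner :: "'a \<Rightarrow> 'a \<Rightarrow> complex"
  assumes scaleC_add_right: "c *\<^sub>C (x + y) = c *\<^sub>C x + c *\<^sub>C y"
    and scaleC_add_left: "(c + d) *\<^sub>C x = c *\<^sub>C x + d *\<^sub>C x"
    and scaleC_scaleC: "c *\<^sub>C (d *\<^sub>C x) = (c * d) *\<^sub>C x"
    and scaleC_of_real: "complex_of_real r *\<^sub>C x = r *\<^sub>R x"
    and cinner_add_left: "cinner (x + y) z = cinner x z + cinner y z"
    and cinner_scaleC_left: "cinner (c *\<^sub>C x) y = c * cinner x y"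
    and cinner_commute: "cinner x y = cnj (cinner y x)"
    and inner_eq_Re_cinner: "inner x y = Re (cinner x y)"

instantiation complex :: chilbert_space
begin

definition scaleC_complex :: "complex \<Rightarrow> complex \<Rightarrow> complex"
  where "scaleC_complex c x = c * x"

definition cinner_complex :: "complex \<Rightarrow> complex \<Rightarrow> complex"
  where "cinner_complex x y = x * cnj y"

instance
  by standard
    (auto simp: scaleC_complex_def cinner_complex_def inner_complex_def algebra_simps
      scaleR_conv_of_real)

end

definition csubspace :: "'h::chilbert_space set \<Rightarrow> bool" where
  "csubspace D \<longleftrightarrow> 0 \<in> D \<and> (\<forall>x\<in>D. \<forall>y\<in>D. x + y \<in> D) \<and> (\<forall>c. \<forall>x\<in>D. c *\<^sub>C x \<in> D)"

definition orth_proj :: "'h::chilbert_space set \<Rightarrow> 'h \<Rightarrow> 'h" where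
  "orth_proj S x = (THE y. y \<in> S \<and> (\<forall>s\<in>S. cinner (x - y) s = 0))"

text \<open>An orthonormal basis is a maximal orthonormal set; no separability is assumed.\<close>

definition is_onb :: "'h::chilbert_space set \<Rightarrow> bool" where
  "is_onb E \<longleftrightarrow> (\<forall>e\<in>E. \<forall>f\<in>E. cinner e f = (if e = f then 1 else 0)) \<and>
     (\<forall>x. (\<forall>e\<in>E. cinner x e = 0) \<longrightarrow> x = 0)"

section \<open>Operators\<close>

text \<open>Bounded operators are plain functions satisfying the following predicate.\<close>

definition bounded_clinear :: "('h::chilbert_space \<Rightarrow> 'g::chilbert_space) \<Rightarrow> bool" where
  "bounded_clinear T \<longleftrightarrow> bounded_linear T \<and> (\<forall>c x. T (c *\<^sub>C x) = c *\<^sub>C T x)"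

definition adj :: "('h::chilbert_space \<Rightarrow> 'h) \<Rightarrow> ('h \<Rightarrow> 'h)" where
  "adj T = (THE S. bounded_clinear S \<and> (\<forall>x y. cinner (T x) y = cinner x (S y)))"

text \<open>The trace, meaningful for trace class operators, where it does not depend on the chosen
  orthonormal basis.\<close>

definition trace_op :: "('h::chilbert_space \<Rightarrow> 'h) \<Rightarrow> complex" where
  "trace_op T = (\<Sum>\<^sub>\<infinity>e\<in>(SOME E. is_onb E). cinner (T e) e)"

definition hs_inner :: "('h::chilbert_space \<Rightarrow> 'h) \<Rightarrow> ('h \<Rightarrow> 'h) \<Rightarrow> complex" where
  "hs_inner S T = trace_op (adj T \<circ> S)"

text \<open>A possibly unbounded operator is a pair of a domain \<open>D\<close> and a function \<open>Y\<close>; the values of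
  \<open>Y\<close> outside \<open>D\<close> are irrelevant.\<close>

definition antisymmetric_op :: "'h::chilbert_space set \<Rightarrow> ('h \<Rightarrow> 'h) \<Rightarrow> bool" where
  "antisymmetric_op D Y \<longleftrightarrow> csubspace D \<and> closure D = UNIV \<and>
     (\<forall>x\<in>D. \<forall>y\<in>D. Y (x + y) = Y x + Y y) \<and> (\<forall>c. \<forall>x\<in>D. Y (c *\<^sub>C x) = c *\<^sub>C Y x) \<and>
     (\<forall>x\<in>D. \<forall>y\<in>D. cinner (Y x) y = - cinner x (Y y))"

section \<open>Tracial von Neumann algebras\<close>

definition unital_star_algebra :: "('k::chilbert_space \<Rightarrow> 'k) set \<Rightarrow> bool" where
  "unital_star_algebra M \<longleftrightarrow> (\<forall>a\<in>M. bounded_clinear a) \<and> id \<in> M \<and>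
     (\<forall>a\<in>M. \<forall>b\<in>M. (\<lambda>x. a x + b x) \<in> M) \<and> (\<forall>c. \<forall>a\<in>M. (\<lambda>x. c *\<^sub>C a x) \<in> M) \<and>
     (\<forall>a\<in>M. \<forall>b\<in>M. a \<circ> b \<in> M) \<and> (\<forall>a\<in>M. adj a \<in> M)"

definition commutant :: "('k::chilbert_space \<Rightarrow> 'k) set \<Rightarrow> ('k \<Rightarrow> 'k) set" where
  "commutant S = {T. bounded_clinear T \<and> (\<forall>A\<in>S. T \<circ> A = A \<circ> T)}"

definition von_neumann_algebra :: "('k::chilbert_space \<Rightarrow> 'k) set \<Rightarrow> bool" where
  "von_neumann_algebra M \<longleftrightarrow> unital_star_algebra M \<and> commutant (commutant M) = M"

definition vN_generated :: "('k::chilbert_space \<Rightarrow> 'k) set \<Rightarrow> ('k \<Rightarrow> 'k) set" where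
  "vN_generated S = \<Inter> {N. von_neumann_algebra N \<and> S \<subseteq> N}"

text \<open>The ultraweak topology on the bounded operators is the initial topology of the functionals
  \<open>T \<mapsto> (\<Sum>n. \<langle>T (\<xi> n), \<eta> n\<rangle>)\<close> for square summable sequences \<open>\<xi>\<close> and \<open>\<eta>\<close>.\<close>

definition ultraweak :: "('k::chilbert_space \<Rightarrow> 'k) topology" where
  "ultraweak = topology_generated_by
     {{T. bounded_clinear T \<and> suminf (\<lambda>n. cinner (T (\<xi> n)) (\<eta> n)) \<in> U} | \<xi> \<eta> U.
        summable (\<lambda>n::nat. (norm (\<xi> n))\<^sup>2) \<and> summable (\<lambda>n. (norm (\<eta> n))\<^sup>2) \<and> open U}"

definition positive_op :: "('k::chilbert_space \<Rightarrow> 'k) \<Rightarrow> bool" where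
  "positive_op a \<longleftrightarrow> (\<forall>x. cinner (a x) x \<in> \<real> \<and> 0 \<le> Re (cinner (a x) x))"

definition faithful_normal_tracial_state ::
  "('k::chilbert_space \<Rightarrow> 'k) set \<Rightarrow> (('k \<Rightarrow> 'k) \<Rightarrow> complex) \<Rightarrow> bool" where
  "faithful_normal_tracial_state M \<tau> \<longleftrightarrow>
     (\<forall>a\<in>M. \<forall>b\<in>M. \<tau> (\<lambda>x. a x + b x) = \<tau> a + \<tau> b) \<and>
     (\<forall>c. \<forall>a\<in>M. \<tau> (\<lambda>x. c *\<^sub>C a x) = c * \<tau> a) \<and>
     (\<forall>a\<in>M. positive_op a \<longrightarrow> \<tau> a \<in> \<real> \<and> 0 \<le> Re (\<tau> a)) \<and>
     \<tau> id = 1 \<and>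
     (\<forall>a\<in>M. \<forall>b\<in>M. \<tau> (a \<circ> b) = \<tau> (b \<circ> a)) \<and>
     (\<forall>a\<in>M. positive_op a \<longrightarrow> \<tau> a = 0 \<longrightarrow> a = (\<lambda>x. 0)) \<and>
     continuous_map (subtopology ultraweak M) euclidean \<tau>"

definition tracial_vN_algebra ::
  "('k::chilbert_space \<Rightarrow> 'k) set \<Rightarrow> (('k \<Rightarrow> 'k) \<Rightarrow> complex) \<Rightarrow> bool" where
  "tracial_vN_algebra M \<tau> \<longleftrightarrow> von_neumann_algebra M \<and> faithful_normal_tracial_state M \<tau>"

text \<open>The type \<open>'h\<close> together with \<open>\<pi>\<close> and \<open>\<Omega>\<close> is a model of \<open>L\<^sup>2(M, \<tau>)\<close>, unique up to unitary
  equivalence: \<open>\<pi>\<close> is the action of \<open>M\<close> by left multiplication, \<open>\<Omega>\<close> is the trace vector \<open>1\<close>, and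
  \<open>a \<in> M\<close> is viewed as the vector \<open>\<pi> a \<Omega>\<close>.\<close>

definition gns_triple ::
  "('k::chilbert_space \<Rightarrow> 'k) set \<Rightarrow> (('k \<Rightarrow> 'k) \<Rightarrow> complex) \<Rightarrow>
   (('k \<Rightarrow> 'k) \<Rightarrow> ('h::chilbert_space \<Rightarrow> 'h)) \<Rightarrow> 'h \<Rightarrow> bool" where
  "gns_triple M \<tau> \<pi> \<Omega> \<longleftrightarrow>
     (\<forall>a\<in>M. bounded_clinear (\<pi> a)) \<and> \<pi> id = id \<and>
     (\<forall>a\<in>M. \<forall>b\<in>M. \<pi> (\<lambda>x. a x + b x) = (\<lambda>\<zeta>. \<pi> a \<zeta> + \<pi> b \<zeta>)) \<and>
     (\<forall>c. \<forall>a\<in>M. \<pi> (\<lambda>x. c *\<^sub>C a x) = (\<lambda>\<zeta>. c *\<^sub>C \<pi> a \<zeta>)) \<and>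
     (\<forall>a\<in>M. \<forall>b\<in>M. \<pi> (a \<circ> b) = \<pi> a \<circ> \<pi> b) \<and>
     (\<forall>a\<in>M. \<pi> (adj a) = adj (\<pi> a)) \<and>
     (\<forall>a\<in>M. cinner (\<pi> a \<Omega>) \<Omega> = \<tau> a) \<and>
     closure ((\<lambda>a. \<pi> a \<Omega>) ` M) = UNIV"

section \<open>Non-commutative polynomials and free Fisher information\<close>

text \<open>Formal non-commutative polynomials in variables indexed by \<open>'i\<close> are finitely supported
  functions on words. Below, \<open>X\<close> is a family of operators on \<open>L\<^sup>2(M)\<close> and \<open>\<Omega>\<close> the trace vector.\<close>

type_synonym 'i ncpoly = "'i list \<Rightarrow>\<^sub>0 complex"

definition word_op :: "('i \<Rightarrow> 'h \<Rightarrow> 'h) \<Rightarrow> 'i list \<Rightarrow> ('h \<Rightarrow> 'h)" where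
  "word_op X w = foldr (\<lambda>i T. X i \<circ> T) w id"

definition ncpoly_op :: "('i \<Rightarrow> 'h::chilbert_space \<Rightarrow> 'h) \<Rightarrow> 'i ncpoly \<Rightarrow> ('h \<Rightarrow> 'h)" where
  "ncpoly_op X p = (\<lambda>\<zeta>. \<Sum>w\<in>Poly_Mapping.keys p. Poly_Mapping.lookup p w *\<^sub>C word_op X w \<zeta>)"

definition ncpoly_vectors :: "('i \<Rightarrow> 'h::chilbert_space \<Rightarrow> 'h) \<Rightarrow> 'h \<Rightarrow> 'h set" where
  "ncpoly_vectors X \<Omega> = range (\<lambda>p. ncpoly_op X p \<Omega>)"

definition P1 :: "'h::chilbert_space \<Rightarrow> ('h \<Rightarrow> 'h)" where
  "P1 \<Omega> = orth_proj (range (\<lambda>c. c *\<^sub>C \<Omega>))"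

definition deriv_word ::
  "('i \<Rightarrow> 'h::chilbert_space \<Rightarrow> 'h) \<Rightarrow> 'h \<Rightarrow> 'i \<Rightarrow> 'i list \<Rightarrow> ('h \<Rightarrow> 'h)" where
  "deriv_word X \<Omega> j w = (\<lambda>\<zeta>. \<Sum>l | l < length w \<and> w ! l = j.
     word_op X (take l w) (P1 \<Omega> (word_op X (drop (Suc l) w) \<zeta>)))"

definition ncpoly_deriv ::
  "('i \<Rightarrow> 'h::chilbert_space \<Rightarrow> 'h) \<Rightarrow> 'h \<Rightarrow> 'i \<Rightarrow> 'i ncpoly \<Rightarrow> ('h \<Rightarrow> 'h)" where
  "ncpoly_deriv X \<Omega> j p =
     (\<lambda>\<zeta>. \<Sum>w\<in>Poly_Mapping.keys p. Poly_Mapping.lookup p w *\<^sub>C deriv_word X \<Omega> j w \<zeta>)"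

definition is_conjugate_variable ::
  "('i \<Rightarrow> 'h::chilbert_space \<Rightarrow> 'h) \<Rightarrow> 'h \<Rightarrow> 'i \<Rightarrow> 'h \<Rightarrow> bool" where
  "is_conjugate_variable X \<Omega> j \<xi> \<longleftrightarrow>
     (\<forall>p. cinner \<xi> (ncpoly_op X p \<Omega>) = hs_inner (P1 \<Omega>) (ncpoly_deriv X \<Omega> j p))"

text \<open>The vector \<open>\<partial>\<^sub>j\<^sup>*(P\<^sub>1)\<close> is unique when it exists, provided the polynomials are dense in
  \<open>L\<^sup>2(M)\<close>, i.e. when the \<open>X\<close> generate \<open>M\<close>.\<close>

definition conjugate_variable :: "('i \<Rightarrow> 'h::chilbert_space \<Rightarrow> 'h) \<Rightarrow> 'h \<Rightarrow> 'i \<Rightarrow> 'h" where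
  "conjugate_variable X \<Omega> j = (THE \<xi>. is_conjugate_variable X \<Omega> j \<xi>)"

definition free_fisher_information ::
  "('i::finite \<Rightarrow> 'h::chilbert_space \<Rightarrow> 'h) \<Rightarrow> 'h \<Rightarrow> ennreal" where
  "free_fisher_information X \<Omega> =
     (if \<forall>j. \<exists>\<xi>. is_conjugate_variable X \<Omega> j \<xi>
      then ennreal (\<Sum>j\<in>UNIV. (norm (conjugate_variable X \<Omega> j))\<^sup>2) else \<infinity>)"

end

theory Submission
  imports Defs
begin

text \<open>If \<open>\<xi> = \<partial>\<^sub>j\<^sup>*(P\<^sub>1)\<close>, then \<open>Y p\<Omega> = \<partial>\<^sub>j(p)\<Omega> - p\<xi>/2\<close> is well defined, anti-symmetric and has the required
  commutators; conversely, given \<open>Y\<close>, the commutation relations give \<open>Y p\<Omega> = \<partial>\<^sub>j(p)\<Omega> + pY\<Omega>\<close>, and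
  anti-symmetry shows that \<open>\<xi> = - Y\<Omega> - JY\<Omega>\<close> is the conjugate variable, where \<open>J\<close> is the modular
  conjugation. The first direction uses that the polynomials in the \<open>X\<close> are dense in \<open>L\<^sup>2(M)\<close>: by the
  double commutant theorem on \<open>\<ell>\<^sup>2(\<nat>) \<otimes> K\<close>, where \<open>M\<close> acts on \<open>K\<close>, polynomials approximate \<open>a \<in> M\<close> ultrastrongly, and
  the normal trace turns this into approximation in \<open>L\<^sup>2(M)\<close>.\<close>

section \<open>Complex inner products\<close>

text \<open>The \<open>X\<close> may satisfy polynomial relations, so \<partial>_j is visibly a
  function of the formal polynomial p only, not of the vector p\<Omega>. Anti-symmetry, checked word
  by word, repairs this: polynomials with the same vector get values that agree when paired with a
  dense set. The factor 1/2 arises because \<partial>_j fails to be anti-symmetric by one Leibniz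
  term, and \<xi> reproduces that whole term in either slot of the inner product. In the density
  argument, \<tau> is normal but no continuity of \<pi> is given. The distance of p\<Omega> from
  a\<Omega> is therefore written as \<tau> of \<open>adj b \<circ> b\<close> with b = p - a, and an
  ultraweak neighbourhood of 0 must be entered. Such neighbourhoods are cut out by square summable
  sequences, so approximation at finitely many vectors of K is too weak, while approximation at a
  single vector of the amplified space is exactly right.\<close>

lemma cinner_add_right: "cinner x (y + z) = cinner x y + cinner x z"
  by (metis cinner_add_left cinner_commute complex_cnj_add)

lemma cinner_scaleC_right: "cinner x (c *\<^sub>C y) = cnj c * cinner x y"
  by (metis cinner_scaleC_left cinner_commute complex_cnj_mult)

lemma cinner_scaleR_left: "cinner (r *\<^sub>R x) y = of_real r * cinner x y"
  by (metis cinner_scaleC_left scaleC_of_real)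

lemma cinner_scaleR_right: "cinner x (r *\<^sub>R y) = of_real r * cinner x y"
  by (metis cinner_scaleC_right scaleC_of_real complex_cnj_complex_of_real)

lemma cinner_self: "cinner x x = of_real ((norm x)\<^sup>2)"
proof -
  have "Im (cinner x x) = 0"
    by (metis cinner_commute complex_cnj_cancel_iff Reals_cnj_iff complex_is_Real_iff)
  moreover have "Re (cinner x x) = (norm x)\<^sup>2"
    by (metis inner_eq_Re_cinner power2_norm_eq_inner)
  ultimately show ?thesis
    by (simp add: complex_eq_iff)
qed

lemma scaleC_zero_left [simp]: "0 *\<^sub>C x = 0"
  using scaleC_of_real[of 0 x] by simp

lemma scaleC_one [simp]: "1 *\<^sub>C x = x"
  using scaleC_of_real[of 1 x] by simp

lemma scaleC_zero_right [simp]: "c *\<^sub>C (0::'h::chilbert_space) = 0"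
  using scaleC_add_right[of c 0 "0::'h"] by simp

lemma scaleC_minus_one: "(-1) *\<^sub>C x = - x"
  using scaleC_of_real[of "-1" x] by simp

lemma norm_scaleC: "norm (c *\<^sub>C x) = cmod c * norm x"
proof -
  have "complex_of_real ((norm (c *\<^sub>C x))\<^sup>2) = complex_of_real ((cmod c * norm x)\<^sup>2)"
    unfolding cinner_self[symmetric] cinner_scaleC_left cinner_scaleC_right
    by (simp add: cinner_self power_mult_distrib mult.assoc[symmetric] complex_norm_square
        del: of_real_power)
  then have "(norm (c *\<^sub>C x))\<^sup>2 = (cmod c * norm x)\<^sup>2"
    by (simp only: of_real_eq_iff)
  then show ?thesis
    by (simp add: power2_eq_iff_nonneg)
qed

text \<open>A phase rotates \<open>cinner x y\<close> onto its modulus, and the real Cauchy-Schwarz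
  inequality then gives the complex one.\<close>

lemma cmod_cinner_le: "cmod (cinner x y) \<le> norm x * norm y"
proof (cases "cinner x y = 0")
  case False
  define c where "c = cnj (sgn (cinner x y))"
  have c: "cmod c = 1"
    using False by (simp add: c_def norm_sgn)
  have "cinner (c *\<^sub>C x) y = of_real (cmod (cinner x y))"
    using False by (simp add: cinner_scaleC_left c_def sgn_div_norm scaleR_conv_of_real
        complex_norm_square[symmetric] power2_eq_square field_simps)
  then have "cmod (cinner x y) = inner (c *\<^sub>C x) y"
    by (simp add: inner_eq_Re_cinner)
  also have "\<dots> \<le> norm (c *\<^sub>C x) * norm y"
    by (rule norm_cauchy_schwarz)
  finally show ?thesis
    by (simp add: norm_scaleC c)
qed simp

lemma bounded_bilinear_cinner: "bounded_bilinear (cinner :: 'h::chilbert_space \<Rightarrow> 'h \<Rightarrow> complex)"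
  by standard
    (auto simp: cinner_add_left cinner_add_right cinner_scaleR_left cinner_scaleR_right
      scaleR_conv_of_real intro!: exI[of _ 1] cmod_cinner_le)

lemma bounded_bilinear_scaleC: "bounded_bilinear (scaleC :: complex \<Rightarrow> 'h::chilbert_space \<Rightarrow> 'h)"
proof
  fix r c and x :: 'h
  show "(r *\<^sub>R c) *\<^sub>C x = r *\<^sub>R (c *\<^sub>C x)"
    by (metis scaleC_of_real scaleC_scaleC scaleR_conv_of_real)
  show "c *\<^sub>C (r *\<^sub>R x) = r *\<^sub>R (c *\<^sub>C x)"
    by (metis scaleC_of_real scaleC_scaleC mult.commute)
  show "\<exists>K. \<forall>c (x::'h). norm (c *\<^sub>C x) \<le> norm c * norm x * K"
    by (intro exI[of _ 1]) (simp add: norm_scaleC)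
qed (simp_all add: scaleC_add_left scaleC_add_right)

interpretation cinner: bounded_bilinear cinner
  by (rule bounded_bilinear_cinner)

interpretation scaleC: bounded_bilinear scaleC
  by (rule bounded_bilinear_scaleC)

lemma cinner_eq_zero_commute: "cinner x y = 0 \<longleftrightarrow> cinner y x = 0"
  by (metis cinner_commute complex_cnj_zero)

lemma cinner_self_eq_zero_iff: "cinner x x = 0 \<longleftrightarrow> x = 0"
  by (simp add: cinner_self)

lemma cinner_eqI:
  assumes "\<And>y. cinner x y = cinner x' y"
  shows "x = x'"
proof -
  have "cinner (x - x') (x - x') = 0"
    using assms by (simp add: cinner.diff_left)
  then show ?thesis
    by (simp add: cinner_self_eq_zero_iff)
qed

lemma cinner_eqI_right:
  assumes "\<And>y. cinner y x = cinner y x'"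
  shows "x = x'"
  by (rule cinner_eqI) (metis assms cinner_commute)

lemma cinner_zero_dense:
  assumes "closure D = UNIV" "\<And>y. y \<in> D \<Longrightarrow> cinner x y = 0"
  shows "x = 0"
proof -
  have "closed {y. cinner x y = 0}"
    by (intro closed_Collect_eq continuous_intros cinner.continuous_on)
  then have "closure D \<subseteq> {y. cinner x y = 0}"
    using assms(2) by (intro closure_minimal) auto
  then have "cinner x x = 0"
    using assms(1) by auto
  then show ?thesis
    by (simp add: cinner_self_eq_zero_iff)
qed

section \<open>Closed subspaces and the Riesz representation\<close>

lemma csubspace_uminus: "csubspace S \<Longrightarrow> x \<in> S \<Longrightarrow> - x \<in> S"
  unfolding csubspace_def by (metis scaleC_minus_one)

lemma csubspace_diff: "csubspace S \<Longrightarrow> x \<in> S \<Longrightarrow> y \<in> S \<Longrightarrow> x - y \<in> S"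
  using csubspace_uminus[of S y] unfolding csubspace_def
  by (metis diff_conv_add_uminus)

lemma csubspace_imp_subspace: "csubspace S \<Longrightarrow> subspace S"
  unfolding csubspace_def subspace_def by (metis scaleC_of_real)

lemma csubspace_closure:
  assumes "csubspace S"
  shows "csubspace (closure S)"
  unfolding csubspace_def
proof safe
  show "0 \<in> closure S"
    using assms closure_subset by (auto simp: csubspace_def)
next
  fix x y assume "x \<in> closure S" "y \<in> closure S"
  then obtain f g where fg: "\<And>n::nat. f n \<in> S" "f \<longlonglongrightarrow> x" "\<And>n::nat. g n \<in> S" "g \<longlonglongrightarrow> y"
    unfolding closure_sequential by auto
  then have "(\<lambda>n. f n + g n) \<longlonglongrightarrow> x + y"
    by (intro tendsto_intros)
  moreover have "f n + g n \<in> S" for n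
    using assms fg by (auto simp: csubspace_def)
  ultimately show "x + y \<in> closure S"
    unfolding closure_sequential by (intro exI[of _ "\<lambda>n. f n + g n"]) auto
next
  fix c x assume "x \<in> closure S"
  then obtain f where f: "\<And>n::nat. f n \<in> S" "f \<longlonglongrightarrow> x"
    unfolding closure_sequential by auto
  then have "(\<lambda>n. c *\<^sub>C f n) \<longlonglongrightarrow> c *\<^sub>C x"
    by (intro scaleC.tendsto tendsto_const)
  moreover have "c *\<^sub>C f n \<in> S" for n
    using assms f(1) by (auto simp: csubspace_def)
  ultimately show "c *\<^sub>C x \<in> closure S"
    unfolding closure_sequential by (intro exI[of _ "\<lambda>n. c *\<^sub>C f n"]) auto
qed

lemma nearest_point_orthogonal:
  fixes x y :: "'a::real_inner"
  assumes "subspace S" "y \<in> S" "s \<in> S" "\<And>z. z \<in> S \<Longrightarrow> norm (x - y) \<le> norm (x - z)"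
  shows "inner (x - y) s = 0"
proof (rule ccontr)
  define a where "a = inner (x - y) s"
  assume "inner (x - y) s \<noteq> 0"
  then have a: "a \<noteq> 0" and s: "inner s s > 0"
    by (auto simp: a_def)
  \<comment> \<open>The minimiser of the quadratic t \<mapsto> |x - y - t s|^2; it would beat y by
    a^2 / |s|^2.\<close>
  define t where "t = a / inner s s"
  have "y + t *\<^sub>R s \<in> S"
    using assms by (simp add: subspace_add subspace_scale)
  from assms(4)[OF this] have "(norm (x - y))\<^sup>2 \<le> (norm (x - y - t *\<^sub>R s))\<^sup>2"
    by (simp add: diff_diff_eq power_mono)
  also have "\<dots> = (norm (x - y))\<^sup>2 - 2 * t * a + t\<^sup>2 * inner s s"
    unfolding power2_norm_eq_inner
    by (simp add: inner_diff_left inner_diff_right a_def inner_commute algebra_simps power2_eq_square)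
  also have "\<dots> = (norm (x - y))\<^sup>2 - a\<^sup>2 / inner s s"
    using s by (simp add: t_def power2_eq_square field_simps)
  finally show False
    using a s by (simp add: divide_le_0_iff not_less[symmetric])
qed

text \<open>A minimising sequence is Cauchy by the parallelogram law: the midpoint of two of its
  members lies in S, hence at distance at least d from x.\<close>

lemma nearest_point_exists:
  fixes x :: "'a::{real_inner, complete_space}"
  assumes "subspace S" "closed S"
  shows "\<exists>y\<in>S. \<forall>z\<in>S. norm (x - y) \<le> norm (x - z)"
proof -
  define d where "d = infdist x S"
  have ne: "S \<noteq> {}"
    using assms(1) subspace_0 by blast
  have dle: "d \<le> norm (x - z)" if "z \<in> S" for z
    using infdist_le[OF that, of x] by (simp add: d_def dist_norm)
  have d0: "d \<ge> 0"
    by (simp add: d_def infdist_nonneg)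
  have "\<exists>y\<in>S. (norm (x - y))\<^sup>2 < d\<^sup>2 + e" if "e > 0" for e
  proof -
    have "d < sqrt (d\<^sup>2 + e)"
      using that d0 by (intro real_less_rsqrt) simp
    then obtain y where y: "y \<in> S" "norm (x - y) < sqrt (d\<^sup>2 + e)"
      using cInf_lessD[of "dist x ` S"] ne
      by (auto simp: d_def infdist_notempty dist_norm)
    then have "(norm (x - y))\<^sup>2 < d\<^sup>2 + e"
      using that d0 power_strict_mono[OF y(2), of 2] by (simp add: add_nonneg_nonneg)
    then show ?thesis
      using y by blast
  qed
  then have "\<forall>n::nat. \<exists>y\<in>S. (norm (x - y))\<^sup>2 < d\<^sup>2 + 1 / Suc n"
    by simp
  then obtain y where yS: "\<And>n. y n \<in> S" and y: "\<And>n::nat. (norm (x - y n))\<^sup>2 < d\<^sup>2 + 1 / Suc n"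
    by metis
  have par: "(norm (y m - y n))\<^sup>2 \<le> 2 / Suc m + 2 / Suc n" for m n
  proof -
    have "(1/2) *\<^sub>R (y m + y n) \<in> S"
      using yS assms by (simp add: subspace_add subspace_scale)
    then have "d\<^sup>2 \<le> (norm (x - (1/2) *\<^sub>R (y m + y n)))\<^sup>2"
      using dle d0 by (simp add: power_mono)
    moreover have "(norm (y m - y n))\<^sup>2 = 2 * (norm (x - y m))\<^sup>2 + 2 * (norm (x - y n))\<^sup>2
       - 4 * (norm (x - (1/2) *\<^sub>R (y m + y n)))\<^sup>2"
      unfolding power2_norm_eq_inner
      by (simp add: inner_diff_left inner_diff_right inner_add_left inner_add_right
          inner_commute algebra_simps)
    ultimately show ?thesis
      using y[of m] y[of n] by simp
  qed
  have "Cauchy y"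
  proof (rule metric_CauchyI)
    fix e :: real assume e: "e > 0"
    then obtain N :: nat where N0: "4 / e\<^sup>2 < real N"
      using reals_Archimedean2 by blast
    moreover have "0 < 4 / e\<^sup>2"
      using e by simp
    ultimately have "0 < real N"
      by (rule less_trans[rotated])
    then have N: "N > 0"
      by simp
    have "4 < real N * e\<^sup>2"
      using N0 e by (subst (asm) pos_divide_less_eq) simp_all
    then have N': "4 / real N < e\<^sup>2"
      using N by (subst pos_divide_less_eq) (simp_all only: of_nat_0_less_iff mult.commute)
    show "\<exists>M. \<forall>m\<ge>M. \<forall>n\<ge>M. dist (y m) (y n) < e"
    proof (intro exI allI impI)
      fix m n assume mn: "m \<ge> N" "n \<ge> N"
      have *: "2 / real (Suc k) \<le> 2 / real N" if "k \<ge> N" for k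
        using that N by (intro divide_left_mono) auto
      have "(norm (y m - y n))\<^sup>2 < e\<^sup>2"
        using par[of m n] *[OF mn(1)] *[OF mn(2)] N' by simp
      then show "dist (y m) (y n) < e"
        using e by (simp add: dist_norm power2_less_imp_less)
    qed
  qed
  then obtain l where l: "y \<longlonglongrightarrow> l"
    by (auto simp: Cauchy_convergent_iff convergent_def)
  then have lS: "l \<in> S"
    using assms(2) yS closed_sequentially by blast
  have "(\<lambda>n. (norm (x - y n))\<^sup>2) \<longlonglongrightarrow> (norm (x - l))\<^sup>2"
    by (intro tendsto_intros l)
  moreover have "(\<lambda>n. d\<^sup>2 + 1 / real (Suc n)) \<longlonglongrightarrow> d\<^sup>2 + 0"
    by (intro tendsto_intros LIMSEQ_Suc[OF lim_1_over_n])
  ultimately have "(norm (x - l))\<^sup>2 \<le> d\<^sup>2"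
    using y by (intro LIMSEQ_le[where X = "\<lambda>n. (norm (x - y n))\<^sup>2"
          and Y = "\<lambda>n. d\<^sup>2 + 1 / real (Suc n)"]) (auto intro: less_imp_le)
  then have "norm (x - l) \<le> d"
    using d0 by (rule power2_le_imp_le)
  then show ?thesis
    using lS dle order_trans by blast
qed

lemma projection_exists:
  assumes "csubspace S" "closed S"
  shows "\<exists>y\<in>S. \<forall>s\<in>S. cinner (x - y) s = 0"
proof -
  obtain y where y: "y \<in> S" "\<And>z. z \<in> S \<Longrightarrow> norm (x - y) \<le> norm (x - z)"
    using nearest_point_exists[OF csubspace_imp_subspace[OF assms(1)] assms(2)] by blast
  have re: "Re (cinner (x - y) s) = 0" if "s \<in> S" for s
    using nearest_point_orthogonal[OF csubspace_imp_subspace[OF assms(1)] y(1) that y(2)]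
    by (simp add: inner_eq_Re_cinner)
  have "cinner (x - y) s = 0" if "s \<in> S" for s
  proof -
    \<comment> \<open>The real part of the pairing with i s is the imaginary part of the pairing
      with s, so the real orthogonality suffices.\<close>
    have "\<i> *\<^sub>C s \<in> S"
      using that assms by (auto simp: csubspace_def)
    from re[OF this] re[OF that] show ?thesis
      by (simp add: cinner_scaleC_right complex_eq_iff)
  qed
  then show ?thesis
    using y(1) by blast
qed

lemma orthogonal_complement_trivial:
  assumes "csubspace S" "\<And>x. (\<And>s. s \<in> S \<Longrightarrow> cinner x s = 0) \<Longrightarrow> x = 0"
  shows "closure S = UNIV"
proof -
  have "x \<in> closure S" for x
  proof -
    obtain y where y: "y \<in> closure S" "\<forall>s\<in>closure S. cinner (x - y) s = 0"
      using projection_exists[OF csubspace_closure[OF assms(1)] closed_closure] by blast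
    have "x - y = 0"
      by (rule assms(2)) (use y closure_subset in blast)
    then show ?thesis
      using y by simp
  qed
  then show ?thesis
    by blast
qed

section \<open>Bounded operators, the Riesz representation and adjoints\<close>

lemma bounded_clinearD:
  assumes "bounded_clinear T"
  shows "bounded_linear T" "T (x + y) = T x + T y" "T (x - y) = T x - T y" "T (c *\<^sub>C x) = c *\<^sub>C T x"
    "T 0 = 0" "T (- x) = - T x" "T (sum f I) = (\<Sum>i\<in>I. T (f i))"
  using assms unfolding bounded_clinear_def
  by (auto simp: linear_add linear_diff linear_0 linear_neg linear_sum bounded_linear.linear)

lemma bounded_clinearI:
  assumes "\<And>x y. T (x + y) = T x + T y" "\<And>c x. T (c *\<^sub>C x) = c *\<^sub>C T x"
    "\<And>x. norm (T x) \<le> norm x * K"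
  shows "bounded_clinear T"
  unfolding bounded_clinear_def
proof safe
  show "bounded_linear T"
  proof (rule bounded_linear_intro[where K = K])
    show "T (r *\<^sub>R x) = r *\<^sub>R T x" for r x
      using assms(2)[of "of_real r" x] by (simp add: scaleC_of_real)
  qed (use assms in auto)
qed (use assms in auto)

lemma bounded_clinear_compose:
  assumes "bounded_clinear S" "bounded_clinear T"
  shows "bounded_clinear (\<lambda>x. S (T x))"
  using assms unfolding bounded_clinear_def by (auto intro: bounded_linear_compose)

lemma bounded_clinear_comp:
  assumes "bounded_clinear S" "bounded_clinear T"
  shows "bounded_clinear (S \<circ> T)"
  using bounded_clinear_compose[OF assms] by (simp add: comp_def)

lemma bounded_clinear_add:
  assumes "bounded_clinear S" "bounded_clinear T"
  shows "bounded_clinear (\<lambda>x. S x + T x)"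
  using assms unfolding bounded_clinear_def by (auto intro: bounded_linear_add simp: scaleC_add_right)

lemma bounded_clinear_scaleC:
  assumes "bounded_clinear T"
  shows "bounded_clinear (\<lambda>x. c *\<^sub>C T x)"
  using assms unfolding bounded_clinear_def
  by (auto intro: bounded_linear_compose[OF scaleC.bounded_linear_right] simp: scaleC_scaleC mult.commute)

lemma bounded_clinear_id [simp]: "bounded_clinear id"
  unfolding bounded_clinear_def by (auto simp: id_def)

lemma bounded_clinear_zero [simp]: "bounded_clinear (\<lambda>x. 0)"
  unfolding bounded_clinear_def by auto

lemma bounded_clinear_sum:
  assumes "\<And>i. i \<in> I \<Longrightarrow> bounded_clinear (T i)"
  shows "bounded_clinear (\<lambda>x. \<Sum>i\<in>I. T i x)"
  using assms
  by (induction I rule: infinite_finite_induct) (auto intro: bounded_clinear_add)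

text \<open>For nonzero f the kernel is a closed hyperplane; a vector z orthogonal to it, suitably
  rescaled, represents f because every x differs from a multiple of z by an element of the
  kernel.\<close>

lemma riesz_representation:
  fixes f :: "'h::chilbert_space \<Rightarrow> complex"
  assumes "bounded_clinear f"
  shows "\<exists>y. \<forall>x. f x = cinner x y"
proof (cases "\<forall>x. f x = 0")
  case True
  then show ?thesis
    by (intro exI[of _ 0]) (simp add: cinner.zero_right)
next
  case False
  then obtain x0 where x0: "f x0 \<noteq> 0"
    by blast
  define N where "N = {x. f x = 0}"
  note f = bounded_clinearD[OF assms]
  have fC: "f (c *\<^sub>C x) = c * f x" for c x
    using f(4) by (simp add: scaleC_complex_def)
  have N: "csubspace N" "closed N"
    unfolding N_def csubspace_def
    by (auto simp: f fC intro!: closed_Collect_eq continuous_intros linear_continuous_on)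
  obtain y where y: "y \<in> N" "\<And>s. s \<in> N \<Longrightarrow> cinner (x0 - y) s = 0"
    using projection_exists[OF N] by blast
  define z where "z = x0 - y"
  have fz: "f z = f x0"
    using y(1) by (simp add: z_def f N_def)
  have nz: "cinner z z \<noteq> 0"
    using fz x0 f(5) by (auto simp: cinner_self_eq_zero_iff)
  have "f x = cinner x ((cnj (f z) / cinner z z) *\<^sub>C z)" for x
  proof -
    have "x - (f x / f z) *\<^sub>C z \<in> N"
      using x0 by (simp add: N_def f(3) fC fz)
    from y(2)[OF this] have "cinner (x - (f x / f z) *\<^sub>C z) z = 0"
      by (metis z_def cinner_eq_zero_commute)
    then have "cinner x z = f x / f z * cinner z z"
      by (simp add: cinner.diff_left cinner_scaleC_left)
    moreover have "cnj (cinner z z) = cinner z z"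
      by (metis cinner_commute)
    ultimately show ?thesis
      using nz x0 fz by (simp add: cinner_scaleC_right)
  qed
  then show ?thesis
    by blast
qed

lemma adj_eqI:
  assumes "bounded_clinear S" "\<And>x y. cinner (T x) y = cinner x (S y)"
  shows "adj T = S"
  unfolding adj_def
proof (rule the_equality)
  fix S' assume S': "bounded_clinear S' \<and> (\<forall>x y. cinner (T x) y = cinner x (S' y))"
  show "S' = S"
  proof (rule ext, rule cinner_eqI_right)
    show "cinner x (S' y) = cinner x (S y)" for x y
      using S' assms(2)[of x y] by metis
  qed
qed (use assms in auto)

lemma bounded_clinear_cinner_left: "bounded_clinear (\<lambda>x. cinner x y)"
  unfolding bounded_clinear_def
  by (auto simp: cinner.bounded_linear_left cinner_scaleC_left scaleC_complex_def)

lemma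
  assumes "bounded_clinear T"
  shows bounded_clinear_adj: "bounded_clinear (adj T)"
    and cinner_adj_right: "cinner x (adj T y) = cinner (T x) y"
proof -
  have "\<exists>z. \<forall>x. cinner (T x) y = cinner x z" for y
    using riesz_representation[OF bounded_clinear_compose[OF bounded_clinear_cinner_left assms]]
    by blast
  then obtain S where S: "\<And>x y. cinner (T x) y = cinner x (S y)"
    by metis
  obtain K where K: "\<And>x. norm (T x) \<le> norm x * K"
    using bounded_clinearD(1)[OF assms] bounded_linear.bounded by blast
  have "bounded_clinear S"
  proof (rule bounded_clinearI)
    show "S (x + y) = S x + S y" for x y
      by (rule cinner_eqI_right) (simp add: S[symmetric] cinner_add_right)
    show "S (c *\<^sub>C x) = c *\<^sub>C S x" for c x
      by (rule cinner_eqI_right) (simp add: S[symmetric] cinner_scaleC_right)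
    show "norm (S x) \<le> norm x * K" for x
    proof (cases "S x = 0")
      case True
      have "0 \<le> norm x * K"
        using K[of x] norm_ge_zero order_trans by blast
      then show ?thesis
        using True by simp
    next
      case False
      \<comment> \<open>Pairing S x with itself lets the bound K of T serve as a bound of S.\<close>
      have "complex_of_real ((norm (S x))\<^sup>2) = cinner (T (S x)) x"
        by (simp add: cinner_self[symmetric] S del: of_real_power)
      then have "(norm (S x))\<^sup>2 = cmod (cinner (T (S x)) x)"
        by (metis abs_of_nonneg norm_of_real zero_le_power2)
      also have "\<dots> \<le> norm (T (S x)) * norm x"
        by (rule cmod_cinner_le)
      also have "\<dots> \<le> norm (S x) * K * norm x"
        using K by (intro mult_right_mono) auto
      finally show ?thesis
        using False by (simp add: power2_eq_square mult.assoc mult.commute)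
    qed
  qed
  then show "bounded_clinear (adj T)" "cinner x (adj T y) = cinner (T x) y"
    using adj_eqI[of S T] S by auto
qed

lemma cinner_adj_left:
  assumes "bounded_clinear T"
  shows "cinner (adj T x) y = cinner x (T y)"
  by (metis assms cinner_adj_right cinner_commute)

lemma adj_adj: "bounded_clinear T \<Longrightarrow> adj (adj T) = T"
  by (intro adj_eqI) (simp_all add: cinner_adj_left)

section \<open>Orthonormal bases and the Hilbert--Schmidt pairing with a rank one projection\<close>

text \<open>Makes the \<open>SOME\<close> in \<open>trace_op\<close> meaningful in any dimension.
  Zorn's lemma gives a maximal orthonormal set; a nonzero vector orthogonal to it could be
  normalised and adjoined.\<close>

lemma onb_exists: "\<exists>E :: 'h::chilbert_space set. is_onb E"
proof -
  define orthonormal where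
    "orthonormal = {E :: 'h set. \<forall>e\<in>E. \<forall>f\<in>E. cinner e f = (if e = f then 1 else 0)}"
  have "\<exists>E\<in>orthonormal. \<forall>F\<in>orthonormal. E \<subseteq> F \<longrightarrow> F = E"
  proof (rule subset_Zorn')
    fix C assume C: "subset.chain orthonormal C"
    have "cinner e f = (if e = f then 1 else 0)" if ef: "e \<in> A" "A \<in> C" "f \<in> B" "B \<in> C" for e f A B
    proof -
      have "A \<subseteq> B \<or> B \<subseteq> A"
        using C ef by (auto simp: subset.chain_def)
      then obtain G where "G \<in> C" "e \<in> G" "f \<in> G"
        using ef by blast
      then show ?thesis
        using C by (auto simp: subset.chain_def orthonormal_def)
    qed
    then show "\<Union>C \<in> orthonormal"
      unfolding orthonormal_def by blast
  qed
  then obtain E where E: "E \<in> orthonormal" and max: "\<And>F. F \<in> orthonormal \<Longrightarrow> E \<subseteq> F \<Longrightarrow> F = E"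
    by blast
  have "x = 0" if x: "\<And>e. e \<in> E \<Longrightarrow> cinner x e = 0" for x
  proof (rule ccontr)
    assume nz: "x \<noteq> 0"
    define u where "u = (1 / norm x) *\<^sub>R x"
    have u: "cinner u u = 1"
      using nz by (simp add: cinner_self u_def)
    have ue: "cinner u e = 0" "cinner e u = 0" if "e \<in> E" for e
      using x[OF that] cinner_eq_zero_commute[of x e] by (auto simp: u_def cinner_scaleR_left cinner_scaleR_right)
    have "insert u E \<in> orthonormal"
      using E ue u unfolding orthonormal_def by auto
    then have "u \<in> E"
      using max by blast
    with ue u show False
      by force
  qed
  with E have "is_onb E"
    unfolding is_onb_def orthonormal_def by blast
  then show ?thesis
    by blast
qed

text \<open>The span of \<open>E\<close> is described as the union of the double orthogonal complements of the finite
  subsets of \<open>E\<close>: this makes the best approximation property immediate.\<close>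

lemma onb_has_sum:
  assumes "is_onb E"
  shows "((\<lambda>e. cinner x e *\<^sub>C e) has_sum x) E"
proof -
  define V where "V = {v. \<exists>F. finite F \<and> F \<subseteq> E \<and> (\<forall>r. (\<forall>e\<in>F. cinner r e = 0) \<longrightarrow> cinner r v = 0)}"
  have "csubspace V"
    unfolding csubspace_def
  proof (intro conjI ballI allI)
    show "0 \<in> V"
      by (auto simp: V_def cinner.zero_right)
    show "c *\<^sub>C v \<in> V" if "v \<in> V" for c v
      using that by (auto simp: V_def cinner_scaleC_right)
    show "v + w \<in> V" if vw: "v \<in> V" "w \<in> V" for v w
    proof -
      from vw obtain F G where "finite F" "F \<subseteq> E" "\<And>r. (\<forall>e\<in>F. cinner r e = 0) \<Longrightarrow> cinner r v = 0"
        "finite G" "G \<subseteq> E" "\<And>r. (\<forall>e\<in>G. cinner r e = 0) \<Longrightarrow> cinner r w = 0"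
        unfolding V_def by blast
      then show ?thesis
        unfolding V_def by (intro CollectI exI[of _ "F \<union> G"]) (simp add: cinner_add_right)
    qed
  qed
  moreover have "y = 0" if y: "\<And>v. v \<in> V \<Longrightarrow> cinner y v = 0" for y
  proof -
    have "e \<in> V" if "e \<in> E" for e
      unfolding V_def using that by (intro CollectI exI[of _ "{e}"]) simp
    then show ?thesis
      using assms y unfolding is_onb_def by blast
  qed
  ultimately have V: "closure V = UNIV"
    by (rule orthogonal_complement_trivial)
  show ?thesis
    unfolding has_sum_def tendsto_iff
  proof (intro allI impI)
    fix \<epsilon> :: real assume \<epsilon>: "\<epsilon> > 0"
    obtain v where v: "v \<in> V" "dist v x < \<epsilon>"
      using V \<epsilon> closure_approachable[of x V] by auto
    then obtain F where F: "finite F" "F \<subseteq> E" "\<And>r. (\<forall>e\<in>F. cinner r e = 0) \<Longrightarrow> cinner r v = 0"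
      unfolding V_def by blast
    have "dist (\<Sum>e\<in>G. cinner x e *\<^sub>C e) x < \<epsilon>" if G: "finite G" "F \<subseteq> G" "G \<subseteq> E" for G
    proof -
      define s where "s = (\<Sum>e\<in>G. cinner x e *\<^sub>C e)"
      define r where "r = x - s"
      have re: "cinner r e = 0" if "e \<in> G" for e
      proof -
        have "cinner s e = (\<Sum>f\<in>G. cinner x f * (if f = e then 1 else 0))"
          unfolding s_def cinner.sum_left using assms G that
          by (intro sum.cong) (auto simp: cinner_scaleC_left is_onb_def subset_iff)
        also have "\<dots> = cinner x e"
          using G that by (simp add: if_distrib[of "(*) _"] cong: if_cong)
        finally show ?thesis
          by (simp add: r_def cinner.diff_left)
      qed
      have rs: "cinner r s = 0"
        unfolding s_def by (simp add: cinner.sum_right cinner_scaleC_right re)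
      have rv: "cinner r v = 0"
        using F(3) G re by blast
      \<comment> \<open>The residual r is orthogonal to the partial sum s and to v, so |r| \<le> |x
        - v|: every partial sum over a set containing F is at least as close to x as v.\<close>
      have "cinner r r = cinner r (x - v)"
        using rs rv by (simp add: r_def cinner.diff_right)
      then have "(norm r)\<^sup>2 = cmod (cinner r (x - v))"
        using cinner_self[of r] by (metis abs_of_nonneg norm_of_real zero_le_power2)
      also have "\<dots> \<le> norm r * norm (x - v)"
        by (rule cmod_cinner_le)
      finally have "norm r \<le> norm (x - v)"
        by (cases "r = 0") (simp_all add: power2_eq_square)
      then show ?thesis
        using v(2) by (simp add: dist_norm r_def s_def norm_minus_commute)
    qed
    then show "\<forall>\<^sub>F G in finite_subsets_at_top E. dist (\<Sum>e\<in>G. cinner x e *\<^sub>C e) x < \<epsilon>"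
      unfolding eventually_finite_subsets_at_top using F by blast
  qed
qed

lemma onb_parseval:
  assumes "is_onb E"
  shows "((\<lambda>e. cinner x e * cinner e y) has_sum cinner x y) E"
  using has_sum_bounded_linear[OF cinner.bounded_linear_left onb_has_sum[OF assms]]
  by (simp add: cinner_scaleC_left)

lemma P1_eq:
  assumes "norm \<Omega> = 1"
  shows "P1 \<Omega> x = cinner x \<Omega> *\<^sub>C \<Omega>"
  unfolding P1_def orth_proj_def
proof (rule the_equality)
  have O: "cinner \<Omega> \<Omega> = 1"
    by (simp add: cinner_self assms)
  show "cinner x \<Omega> *\<^sub>C \<Omega> \<in> range (\<lambda>c. c *\<^sub>C \<Omega>) \<and>
      (\<forall>s\<in>range (\<lambda>c. c *\<^sub>C \<Omega>). cinner (x - cinner x \<Omega> *\<^sub>C \<Omega>) s = 0)"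
    by (auto simp: cinner.diff_left cinner_scaleC_left cinner_scaleC_right O)
  fix y assume y: "y \<in> range (\<lambda>c. c *\<^sub>C \<Omega>) \<and> (\<forall>s\<in>range (\<lambda>c. c *\<^sub>C \<Omega>). cinner (x - y) s = 0)"
  then obtain c where c: "y = c *\<^sub>C \<Omega>"
    by blast
  have "cinner (x - y) (1 *\<^sub>C \<Omega>) = 0"
    using y by blast
  then have "cinner x \<Omega> = c"
    by (simp add: cinner.diff_left cinner_scaleC_left O c)
  then show "y = cinner x \<Omega> *\<^sub>C \<Omega>"
    by (simp add: c)
qed

lemma bounded_clinear_P1:
  assumes "norm \<Omega> = 1"
  shows "bounded_clinear (P1 \<Omega>)"
  by (rule bounded_clinearI[where K = 1])
    (use cmod_cinner_le[of _ \<Omega>] assms in \<open>auto simp: P1_eq cinner_add_left scaleC_add_left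
      cinner_scaleC_left scaleC_scaleC norm_scaleC\<close>)

text \<open>The composite \<open>adj T \<circ> P1 \<Omega>\<close> sends x to <x, \<Omega>> times
  \<open>adj T \<Omega>\<close>, so its trace is a Parseval sum, the same for whichever basis
  \<open>SOME\<close> selects. All Hilbert-Schmidt pairings thereby become pairings of
  vectors.\<close>

lemma hs_inner_P1:
  assumes "norm \<Omega> = 1" "bounded_clinear T"
  shows "hs_inner (P1 \<Omega>) T = cinner \<Omega> (T \<Omega>)"
proof -
  define E :: "'a set" where "E = (SOME E. is_onb E)"
  have E: "is_onb E"
    unfolding E_def using onb_exists by (rule someI_ex)
  have "cinner ((adj T \<circ> P1 \<Omega>) e) e = cinner (adj T \<Omega>) e * cinner e \<Omega>" for e
    by (simp add: P1_eq assms(1) bounded_clinearD[OF bounded_clinear_adj[OF assms(2)]] cinner_scaleC_left)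
  then have "hs_inner (P1 \<Omega>) T = (\<Sum>\<^sub>\<infinity>e\<in>E. cinner (adj T \<Omega>) e * cinner e \<Omega>)"
    unfolding hs_inner_def trace_op_def E_def by simp
  also have "\<dots> = cinner (adj T \<Omega>) \<Omega>"
    by (rule infsumI onb_parseval E)+
  finally show ?thesis
    by (simp add: cinner_adj_left assms(2))
qed

section \<open>Non-commutative polynomials\<close>

text \<open>The linear extension of a map from words to vectors. It is the common form of
  \<open>ncpoly_op\<close> and \<open>ncpoly_deriv\<close>, and leaves g free so that one formal
  polynomial can be evaluated in several ways.\<close>

definition ncpoly_comb :: "'i ncpoly \<Rightarrow> ('i list \<Rightarrow> 'h::chilbert_space) \<Rightarrow> 'h" where
  "ncpoly_comb p g = (\<Sum>w\<in>Poly_Mapping.keys p. Poly_Mapping.lookup p w *\<^sub>C g w)"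

lemma ncpoly_op_eq: "ncpoly_op X p \<zeta> = ncpoly_comb p (\<lambda>w. word_op X w \<zeta>)"
  by (simp add: ncpoly_op_def ncpoly_comb_def)

lemma ncpoly_deriv_eq: "ncpoly_deriv X \<Omega> j p \<zeta> = ncpoly_comb p (\<lambda>w. deriv_word X \<Omega> j w \<zeta>)"
  by (simp add: ncpoly_deriv_def ncpoly_comb_def)

lemma ncpoly_comb_superset:
  assumes "finite K" "Poly_Mapping.keys p \<subseteq> K"
  shows "ncpoly_comb p g = (\<Sum>w\<in>K. Poly_Mapping.lookup p w *\<^sub>C g w)"
  unfolding ncpoly_comb_def using assms
  by (intro sum.mono_neutral_left) (auto simp: in_keys_iff)

lemma ncpoly_comb_zero [simp]: "ncpoly_comb 0 g = 0"
  by (simp add: ncpoly_comb_def)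

lemma ncpoly_comb_add: "ncpoly_comb (p + q) g = ncpoly_comb p g + ncpoly_comb q g"
proof -
  let ?K = "Poly_Mapping.keys p \<union> Poly_Mapping.keys q"
  have "ncpoly_comb (p + q) g = (\<Sum>w\<in>?K. Poly_Mapping.lookup (p + q) w *\<^sub>C g w)"
    by (rule ncpoly_comb_superset) (simp_all add: Poly_Mapping.keys_add)
  also have "\<dots> = (\<Sum>w\<in>?K. Poly_Mapping.lookup p w *\<^sub>C g w) + (\<Sum>w\<in>?K. Poly_Mapping.lookup q w *\<^sub>C g w)"
    by (simp add: lookup_add scaleC_add_left sum.distrib)
  also have "\<dots> = ncpoly_comb p g + ncpoly_comb q g"
    by (simp add: ncpoly_comb_superset[of ?K])
  finally show ?thesis .
qed

lemma ncpoly_comb_single [simp]: "ncpoly_comb (Poly_Mapping.single w c) g = c *\<^sub>C g w"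
  by (subst ncpoly_comb_superset[of "{w}"]) (auto simp: keys_single)

lemma ncpoly_comb_sum: "ncpoly_comb (sum q K) g = (\<Sum>k\<in>K. ncpoly_comb (q k) g)"
  by (induction K rule: infinite_finite_induct) (simp_all add: ncpoly_comb_add)

text \<open>The polynomial q is chosen before g: the same q later represents both a vector and the
  value of the operator on that vector. The map f need not be injective, since the monomials of q
  are summed and coefficients accumulate.\<close>

lemma ncpoly_comb_reindex: "\<exists>q. \<forall>g. ncpoly_comb q g = c *\<^sub>C ncpoly_comb p (\<lambda>w. g (f w))"
proof (intro exI allI)
  fix g
  show "ncpoly_comb (\<Sum>w\<in>Poly_Mapping.keys p. Poly_Mapping.single (f w) (c * Poly_Mapping.lookup p w)) g
    = c *\<^sub>C ncpoly_comb p (\<lambda>w. g (f w))"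
    by (simp add: ncpoly_comb_sum) (simp add: ncpoly_comb_def scaleC.sum_right scaleC_scaleC)
qed

lemma clinear_ncpoly_comb:
  assumes "bounded_clinear T"
  shows "T (ncpoly_comb p g) = ncpoly_comb p (\<lambda>w. T (g w))"
  unfolding ncpoly_comb_def by (simp add: bounded_clinearD[OF assms])

lemma cinner_ncpoly_comb_left:
  "cinner (ncpoly_comb p g) y = (\<Sum>w\<in>Poly_Mapping.keys p. Poly_Mapping.lookup p w * cinner (g w) y)"
  unfolding ncpoly_comb_def by (simp add: cinner.sum_left cinner_scaleC_left)

lemma cinner_ncpoly_comb_right:
  "cinner y (ncpoly_comb p g) = (\<Sum>w\<in>Poly_Mapping.keys p. cnj (Poly_Mapping.lookup p w) * cinner y (g w))"
  unfolding ncpoly_comb_def by (simp add: cinner.sum_right cinner_scaleC_right)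

lemma bounded_clinear_ncpoly_comb:
  assumes "\<And>w. bounded_clinear (g w)"
  shows "bounded_clinear (\<lambda>\<zeta>. ncpoly_comb p (\<lambda>w. g w \<zeta>))"
  unfolding ncpoly_comb_def by (intro bounded_clinear_sum bounded_clinear_scaleC assms)

lemma word_op_Nil [simp]: "word_op X [] = id"
  by (simp add: word_op_def)

lemma word_op_Cons [simp]: "word_op X (i # w) = X i \<circ> word_op X w"
  by (simp add: word_op_def)

lemma word_op_append: "word_op X (u @ v) = word_op X u \<circ> word_op X v"
  by (induction u) auto

lemma bounded_clinear_word_op:
  assumes "\<And>i. bounded_clinear (X i)"
  shows "bounded_clinear (word_op X w)"
  by (induction w) (simp_all add: bounded_clinear_comp assms del: id_apply o_apply)

lemma bounded_clinear_ncpoly_op: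
  assumes "\<And>i. bounded_clinear (X i)"
  shows "bounded_clinear (ncpoly_op X p)"
  using bounded_clinear_ncpoly_comb[OF bounded_clinear_word_op[OF assms]]
  by (simp add: ncpoly_op_eq[abs_def])

lemma deriv_word_Nil [simp]: "deriv_word X \<Omega> j [] = (\<lambda>\<zeta>. 0)"
  by (simp add: deriv_word_def)

text \<open>The Leibniz rule for a leading letter. It turns the sum over positions into a recursion
  on words and is the source of the commutator with \<open>X i\<close>.\<close>

lemma deriv_word_Cons:
  assumes "bounded_clinear (X i)"
  shows "deriv_word X \<Omega> j (i # w) \<zeta> =
    (if i = j then P1 \<Omega> (word_op X w \<zeta>) else 0) + X i (deriv_word X \<Omega> j w \<zeta>)"
proof -
  let ?A = "{l. l < length w \<and> w ! l = j}"
  \<comment> \<open>Position 0 is the new letter; the other positions are those of w moved up by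
    one.\<close>
  have split: "{l. l < length (i # w) \<and> (i # w) ! l = j} = (if i = j then {0} else {}) \<union> Suc ` ?A"
    by (auto simp: nth_Cons' image_iff less_Suc_eq_0_disj split: if_splits)
  have fin: "finite ?A"
    by simp
  show ?thesis
    unfolding deriv_word_def split
    by (subst sum.union_disjoint)
      (use fin in \<open>auto simp: sum.reindex bounded_clinearD[OF assms]\<close>)
qed

lemma bounded_clinear_deriv_word:
  assumes "\<And>i. bounded_clinear (X i)" "norm \<Omega> = 1"
  shows "bounded_clinear (deriv_word X \<Omega> j w)"
  unfolding deriv_word_def
  by (intro bounded_clinear_sum bounded_clinear_compose[OF bounded_clinear_word_op[OF assms(1)]]
      bounded_clinear_compose[OF bounded_clinear_P1[OF assms(2)]] bounded_clinear_word_op assms)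

text \<open>Both sides of the defining equation are conjugate-linear in p, so words suffice, and
  \<open>hs_inner_P1\<close> removes the Hilbert-Schmidt pairing.\<close>

lemma is_conjugate_variable_iff:
  assumes "\<And>i. bounded_clinear (X i)" "norm \<Omega> = 1"
  shows "is_conjugate_variable X \<Omega> j \<xi> \<longleftrightarrow>
    (\<forall>w. cinner \<xi> (word_op X w \<Omega>) = cinner \<Omega> (deriv_word X \<Omega> j w \<Omega>))"
proof -
  have "bounded_clinear (ncpoly_deriv X \<Omega> j p)" for p
    using bounded_clinear_ncpoly_comb[OF bounded_clinear_deriv_word[OF assms]]
    by (simp add: ncpoly_deriv_eq[abs_def])
  then have eq: "is_conjugate_variable X \<Omega> j \<xi> \<longleftrightarrow>
    (\<forall>p. cinner \<xi> (ncpoly_comb p (\<lambda>w. word_op X w \<Omega>)) =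
      cinner \<Omega> (ncpoly_comb p (\<lambda>w. deriv_word X \<Omega> j w \<Omega>)))"
    by (simp add: is_conjugate_variable_def ncpoly_op_eq ncpoly_deriv_eq hs_inner_P1 assms(2))
  show ?thesis
    unfolding eq
  proof (intro iffI allI)
    fix w assume "\<forall>p. cinner \<xi> (ncpoly_comb p (\<lambda>w. word_op X w \<Omega>)) =
      cinner \<Omega> (ncpoly_comb p (\<lambda>w. deriv_word X \<Omega> j w \<Omega>))"
    then show "cinner \<xi> (word_op X w \<Omega>) = cinner \<Omega> (deriv_word X \<Omega> j w \<Omega>)"
      by (auto dest: spec[of _ "Poly_Mapping.single w 1"])
  qed (simp add: cinner_ncpoly_comb_right)
qed

lemma
  assumes "\<And>i. bounded_clinear (X i)"
  shows csubspace_ncpoly_vectors: "csubspace (ncpoly_vectors X \<Omega>)"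
    and ncpoly_vectors_mult: "\<zeta> \<in> ncpoly_vectors X \<Omega> \<Longrightarrow> X i \<zeta> \<in> ncpoly_vectors X \<Omega>"
proof -
  have eq: "ncpoly_vectors X \<Omega> = range (\<lambda>p. ncpoly_comb p (\<lambda>w. word_op X w \<Omega>))"
    by (simp add: ncpoly_vectors_def ncpoly_op_eq)
  show "csubspace (ncpoly_vectors X \<Omega>)"
    unfolding csubspace_def eq
  proof (intro conjI ballI allI)
    show "0 \<in> range (\<lambda>p. ncpoly_comb p (\<lambda>w. word_op X w \<Omega>))"
      by (rule range_eqI[of _ _ 0]) simp
    show "x + y \<in> range (\<lambda>p. ncpoly_comb p (\<lambda>w. word_op X w \<Omega>))"
      if "x \<in> range (\<lambda>p. ncpoly_comb p (\<lambda>w. word_op X w \<Omega>))"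
        "y \<in> range (\<lambda>p. ncpoly_comb p (\<lambda>w. word_op X w \<Omega>))" for x y
      using that by (auto simp: ncpoly_comb_add[symmetric])
    show "c *\<^sub>C x \<in> range (\<lambda>p. ncpoly_comb p (\<lambda>w. word_op X w \<Omega>))"
      if "x \<in> range (\<lambda>p. ncpoly_comb p (\<lambda>w. word_op X w \<Omega>))" for c x
    proof -
      from that obtain p where "x = ncpoly_comb p (\<lambda>w. word_op X w \<Omega>)"
        by blast
      then show ?thesis
        using ncpoly_comb_reindex[of c p "\<lambda>w. w"] by (metis rangeI)
    qed
  qed
  show "X i \<zeta> \<in> ncpoly_vectors X \<Omega>" if "\<zeta> \<in> ncpoly_vectors X \<Omega>"
  proof -
    from that obtain p where p: "\<zeta> = ncpoly_comb p (\<lambda>w. word_op X w \<Omega>)"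
      by (auto simp: eq)
    obtain q where q: "\<And>g :: _ \<Rightarrow> 'b. ncpoly_comb q g = 1 *\<^sub>C ncpoly_comb p (\<lambda>w. g (i # w))"
      using ncpoly_comb_reindex[of 1 p "\<lambda>w. i # w"] by blast
    then have "X i \<zeta> = ncpoly_comb q (\<lambda>w. word_op X w \<Omega>)"
      by (simp add: p q clinear_ncpoly_comb[OF assms])
    then show ?thesis
      by (simp add: eq)
  qed
qed

lemma word_op_in_ncpoly_vectors: "word_op X w \<Omega> \<in> ncpoly_vectors X \<Omega>"
  unfolding ncpoly_vectors_def
  by (rule range_eqI[of _ _ "Poly_Mapping.single w 1"]) (simp add: ncpoly_op_eq)

lemma trace_vector_in_ncpoly_vectors: "\<Omega> \<in> ncpoly_vectors X \<Omega>"
  using word_op_in_ncpoly_vectors[of X "[]" \<Omega>] by simp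

section \<open>Conjugate variables versus anti-symmetric operators\<close>

text \<open>Isolates the combinatorics of words. Density and the modular conjugation enter below as
  assumptions of the two existence lemmas and are supplied later from the trace.\<close>

locale selfadjoint_family =
  fixes X :: "'i \<Rightarrow> 'h::chilbert_space \<Rightarrow> 'h" and \<Omega> :: 'h
  assumes bounded: "\<And>i. bounded_clinear (X i)"
    and selfadjoint: "\<And>i x y. cinner (X i x) y = cinner x (X i y)"
    and norm_trace_vector: "norm \<Omega> = 1"
begin

lemma cinner_P1: "cinner (P1 \<Omega> x) y = cinner x (P1 \<Omega> y)"
  by (simp add: P1_eq norm_trace_vector cinner_scaleC_left cinner_scaleC_right mult.commute)
    (metis cinner_commute mult.commute)

lemma cinner_word_op: "cinner (word_op X w x) y = cinner x (word_op X (rev w) y)"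
  by (induction w arbitrary: x y) (simp_all add: word_op_append selfadjoint)

text \<open>Since the \<open>X i\<close> and P_1 are self-adjoint, \<open>rev v\<close> is the
  adjoint of the word v and \<partial>_j commutes with taking adjoints. The identity is the Leibniz
  rule for the product \<open>rev v @ u\<close>, paired with \<Omega>; it measures how far
  \<partial>_j is from being anti-symmetric.\<close>

lemma deriv_word_adjoint:
  "cinner (deriv_word X \<Omega> j u \<Omega>) (word_op X v \<Omega>) + cinner (word_op X u \<Omega>) (deriv_word X \<Omega> j v \<Omega>)
    = cinner (deriv_word X \<Omega> j (rev v @ u) \<Omega>) \<Omega>"
proof (induction v arbitrary: u)
  case Nil
  show ?case
    by (simp add: cinner.zero_right)
next
  case (Cons i v)
  \<comment> \<open>Moving the letter i from v to u preserves the sum: the P_1 term lost in one slot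
    reappears in the other because P_1 is self-adjoint.\<close>
  have "cinner (deriv_word X \<Omega> j (i # u) \<Omega>) (word_op X v \<Omega>) +
      cinner (word_op X (i # u) \<Omega>) (deriv_word X \<Omega> j v \<Omega>) =
      cinner (deriv_word X \<Omega> j u \<Omega>) (word_op X (i # v) \<Omega>) +
      cinner (word_op X u \<Omega>) (deriv_word X \<Omega> j (i # v) \<Omega>)"
    by (simp add: deriv_word_Cons[OF bounded] cinner_add_left cinner_add_right cinner_P1 selfadjoint
        cinner.zero_left cinner.zero_right)
  with Cons.IH[of "i # u"] show ?case
    by simp
qed

text \<open>With \<open>\<xi> = \<partial>\<^sub>j\<^sup>*(P\<^sub>1)\<close>, the operator is \<open>p \<Omega> \<mapsto> \<partial>\<^sub>j(p) \<Omega> - p \<xi> / 2\<close>: the first term alone has the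
  required commutators, and the second one commutes with the \<open>X\<close> and corrects the symmetry.
  Anti-symmetry on formal polynomials and density of the polynomials make it well defined.\<close>

lemma antisymmetric_op_exists:
  assumes dense: "closure (ncpoly_vectors X \<Omega>) = UNIV"
    and \<xi>: "is_conjugate_variable X \<Omega> j \<xi>"
  shows "\<exists>D Y. antisymmetric_op D Y \<and> ncpoly_vectors X \<Omega> \<subseteq> D \<and>
    (\<forall>i. \<forall>\<zeta>\<in>ncpoly_vectors X \<Omega>. Y (X i \<zeta>) - X i (Y \<zeta>) = (if j = i then P1 \<Omega> \<zeta> else 0))"
proof -
  \<comment> \<open>Each of <u\<xi>, v\<Omega>> and <u\<Omega>, v\<xi>> equals the full defect in
    \<open>deriv_word_adjoint\<close>, hence the factor 1/2.\<close>
  define B where "B w = deriv_word X \<Omega> j w \<Omega> - (1/2) *\<^sub>C word_op X w \<xi>" for w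
  define V where "V p = ncpoly_comb p (\<lambda>w. word_op X w \<Omega>)" for p
  define C where "C p = ncpoly_comb p B" for p
  have V: "ncpoly_vectors X \<Omega> = range V"
    by (simp add: ncpoly_vectors_def ncpoly_op_eq V_def[abs_def])
  have \<xi>1: "cinner \<xi> (word_op X w \<Omega>) = cinner \<Omega> (deriv_word X \<Omega> j w \<Omega>)" for w
    using \<xi> is_conjugate_variable_iff[of X, OF bounded norm_trace_vector] by blast
  have \<xi>2: "cinner (word_op X w \<Omega>) \<xi> = cinner (deriv_word X \<Omega> j w \<Omega>) \<Omega>" for w
    using \<xi>1[of w] by (metis cinner_commute)
  \<comment> \<open>Together with \<open>\<xi>2\<close> this says that \<xi> is fixed by the modular
    conjugation, at least against words; it is what makes the two corrections equal.\<close>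
  have \<xi>3: "cinner (word_op X w \<xi>) \<Omega> = cinner (deriv_word X \<Omega> j w \<Omega>) \<Omega>" for w
    using deriv_word_adjoint[of j "[]" "rev w"]
    by (simp add: cinner_word_op \<xi>1 cinner.zero_left)
  have B: "cinner (B u) (word_op X v \<Omega>) = - cinner (word_op X u \<Omega>) (B v)" for u v
  proof -
    have "cinner (word_op X u \<xi>) (word_op X v \<Omega>) = cinner (deriv_word X \<Omega> j (rev v @ u) \<Omega>) \<Omega>"
      using \<xi>3[of "rev v @ u"] by (simp add: word_op_append cinner_word_op)
    moreover have "cinner (word_op X u \<Omega>) (word_op X v \<xi>) = cinner (deriv_word X \<Omega> j (rev v @ u) \<Omega>) \<Omega>"
      using \<xi>2[of "rev v @ u"] by (simp add: word_op_append cinner_word_op)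
    ultimately show ?thesis
      using deriv_word_adjoint[of j u v, symmetric]
      by (simp add: B_def cinner.diff_left cinner.diff_right cinner_scaleC_left cinner_scaleC_right
          field_simps)
  qed
  have C: "cinner (C p) (V q) = - cinner (V p) (C q)" for p q
    unfolding C_def V_def
    by (simp add: cinner_ncpoly_comb_left cinner_ncpoly_comb_right B sum_negf)
  \<comment> \<open>By \<open>C\<close>, pairing C p - C q with a vector V r gives - <V p - V q, C
    r> = 0.\<close>
  have C_cong: "C p = C q" if "V p = V q" for p q
  proof -
    have "C p - C q = 0"
    proof (rule cinner_zero_dense[OF dense])
      show "cinner (C p - C q) y = 0" if "y \<in> ncpoly_vectors X \<Omega>" for y
        using that \<open>V p = V q\<close> C by (auto simp: V cinner.diff_left)
    qed
    then show ?thesis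
      by simp
  qed
  define Y where "Y \<zeta> = C (SOME p. V p = \<zeta>)" for \<zeta>
  have Y: "Y (V p) = C p" for p
    unfolding Y_def by (rule C_cong, rule someI) (rule refl)
  have add: "V (p + q) = V p + V q" "C (p + q) = C p + C q" for p q
    by (simp_all add: V_def C_def ncpoly_comb_add)
  have "antisymmetric_op (ncpoly_vectors X \<Omega>) Y"
    unfolding antisymmetric_op_def
  proof (intro conjI ballI allI)
    show "Y (x + y) = Y x + Y y" if "x \<in> ncpoly_vectors X \<Omega>" "y \<in> ncpoly_vectors X \<Omega>" for x y
      using that by (auto simp: V Y add simp flip: add(1))
    show "Y (c *\<^sub>C x) = c *\<^sub>C Y x" if "x \<in> ncpoly_vectors X \<Omega>" for c x
    proof -
      from that obtain p where p: "x = V p"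
        by (auto simp: V)
      obtain q where q: "\<And>g :: _ \<Rightarrow> 'h. ncpoly_comb q g = c *\<^sub>C ncpoly_comb p g"
        using ncpoly_comb_reindex[of c p "\<lambda>w. w"] by blast
      have "c *\<^sub>C x = V q" "C q = c *\<^sub>C C p"
        by (simp_all add: p V_def C_def q)
      then show ?thesis
        by (simp add: Y p)
    qed
    show "cinner (Y x) y = - cinner x (Y y)" if "x \<in> ncpoly_vectors X \<Omega>" "y \<in> ncpoly_vectors X \<Omega>" for x y
      using that C by (auto simp: V Y)
  qed (use dense csubspace_ncpoly_vectors[of X \<Omega>, OF bounded] in auto)
  moreover have "Y (X i \<zeta>) - X i (Y \<zeta>) = (if j = i then P1 \<Omega> \<zeta> else 0)"
    if "\<zeta> \<in> ncpoly_vectors X \<Omega>" for i \<zeta>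
  proof -
    from that obtain p where p: "\<zeta> = V p"
      by (auto simp: V)
    obtain q where q: "\<And>g :: _ \<Rightarrow> 'h. ncpoly_comb q g = ncpoly_comb p (\<lambda>w. g (i # w))"
      using ncpoly_comb_reindex[of 1 p "\<lambda>w. i # w"] by auto
    have "X i \<zeta> = V q"
      by (simp add: p V_def q clinear_ncpoly_comb[OF bounded])
    then have "Y (X i \<zeta>) - X i (Y \<zeta>) = ncpoly_comb p (\<lambda>w. B (i # w) - X i (B w))"
      by (simp add: Y p C_def q clinear_ncpoly_comb[OF bounded])
        (simp add: ncpoly_comb_def scaleC.diff_right sum_subtractf)
    \<comment> \<open>The \<xi> terms cancel, since \<xi> is multiplied by words from the left only;
      what remains is the leading Leibniz term.\<close>
    also have "(\<lambda>w. B (i # w) - X i (B w)) = (\<lambda>w. if j = i then P1 \<Omega> (word_op X w \<Omega>) else 0)"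
      by (auto simp: B_def deriv_word_Cons[OF bounded] bounded_clinearD[OF bounded])
    also have "ncpoly_comb p \<dots> = (if j = i then P1 \<Omega> \<zeta> else 0)"
      by (simp add: p V_def clinear_ncpoly_comb[OF bounded_clinear_P1[OF norm_trace_vector]])
        (simp add: ncpoly_comb_def)
    finally show ?thesis .
  qed
  ultimately show ?thesis
    by blast
qed

text \<open>The vector \<eta> stands for JY\<Omega>. Pairing Y(w\<Omega>) = \<partial>_j(w)\<Omega>
  + wY\<Omega> with \<Omega>, anti-symmetry rewrites the left side and \<open>J\<close> the last
  term as pairings of w\<Omega> with a fixed vector.\<close>

lemma conjugate_variable_exists:
  assumes Y: "antisymmetric_op D Y" "ncpoly_vectors X \<Omega> \<subseteq> D"
    and comm: "\<And>i \<zeta>. \<zeta> \<in> ncpoly_vectors X \<Omega> \<Longrightarrow> Y (X i \<zeta>) - X i (Y \<zeta>) = (if j = i then P1 \<Omega> \<zeta> else 0)"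
    and J: "\<And>w. cinner (word_op X w (Y \<Omega>)) \<Omega> = cinner (word_op X w \<Omega>) \<eta>"
  shows "is_conjugate_variable X \<Omega> j (- Y \<Omega> - \<eta>)"
  unfolding is_conjugate_variable_iff[OF bounded norm_trace_vector]
proof
  fix w
  have "Y (word_op X w \<Omega>) = deriv_word X \<Omega> j w \<Omega> + word_op X w (Y \<Omega>)" for w
  proof (induction w)
    case (Cons i w)
    have "Y (word_op X (i # w) \<Omega>) = X i (Y (word_op X w \<Omega>)) + (if j = i then P1 \<Omega> (word_op X w \<Omega>) else 0)"
      using comm[OF word_op_in_ncpoly_vectors, of i w] by (simp add: algebra_simps)
    then show ?case
      by (simp add: Cons.IH deriv_word_Cons[OF bounded] bounded_clinearD[OF bounded])
  qed simp
  moreover have "cinner (Y (word_op X w \<Omega>)) \<Omega> = - cinner (word_op X w \<Omega>) (Y \<Omega>)"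
    using Y word_op_in_ncpoly_vectors trace_vector_in_ncpoly_vectors
    unfolding antisymmetric_op_def by blast
  ultimately have "cinner (deriv_word X \<Omega> j w \<Omega>) \<Omega> = cinner (word_op X w \<Omega>) (- Y \<Omega> - \<eta>)"
    by (simp add: cinner_add_left J cinner.diff_right cinner.minus_right algebra_simps eq_neg_iff_add_eq_0)
  then show "cinner (- Y \<Omega> - \<eta>) (word_op X w \<Omega>) = cinner \<Omega> (deriv_word X \<Omega> j w \<Omega>)"
    by (metis cinner_commute)
qed

end

section \<open>Square summable sequences\<close>

lemma square_summable_add:
  fixes f g :: "nat \<Rightarrow> 'a::real_normed_vector"
  assumes "summable (\<lambda>n. (norm (f n))\<^sup>2)" "summable (\<lambda>n. (norm (g n))\<^sup>2)"
  shows "summable (\<lambda>n. (norm (f n + g n))\<^sup>2)"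
proof (rule summable_comparison_test')
  show "summable (\<lambda>n. 2 * (norm (f n))\<^sup>2 + 2 * (norm (g n))\<^sup>2)"
    by (intro summable_add summable_mult assms)
  show "norm ((norm (f n + g n))\<^sup>2) \<le> 2 * (norm (f n))\<^sup>2 + 2 * (norm (g n))\<^sup>2" for n
  proof -
    have "(norm (f n + g n))\<^sup>2 \<le> (norm (f n) + norm (g n))\<^sup>2"
      by (intro power_mono norm_triangle_ineq norm_ge_zero)
    also have "\<dots> \<le> 2 * (norm (f n))\<^sup>2 + 2 * (norm (g n))\<^sup>2"
      using zero_le_power2[of "norm (f n) - norm (g n)"] by (simp add: power2_eq_square algebra_simps)
    finally show ?thesis
      by simp
  qed
qed

lemma square_summable_bounded_linear:
  assumes "bounded_linear T" "summable (\<lambda>n. (norm (f n))\<^sup>2)"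
  shows "summable (\<lambda>n. (norm (T (f n)))\<^sup>2)"
proof -
  obtain K where K: "\<And>x. norm (T x) \<le> norm x * K"
    using bounded_linear.bounded[OF assms(1)] by blast
  show ?thesis
  proof (rule summable_comparison_test')
    show "summable (\<lambda>n. K\<^sup>2 * (norm (f n))\<^sup>2)"
      by (intro summable_mult assms)
    show "norm ((norm (T (f n)))\<^sup>2) \<le> K\<^sup>2 * (norm (f n))\<^sup>2" for n
      using power_mono[OF K[of "f n"], of 2] by (simp add: power_mult_distrib mult.commute)
  qed
qed

lemma summable_product_of_square_summable:
  fixes B :: "'a::real_normed_vector \<Rightarrow> 'a \<Rightarrow> 'b::banach"
  assumes "\<And>x y. norm (B x y) \<le> norm x * norm y"
    and "summable (\<lambda>n. (norm (f n))\<^sup>2)" "summable (\<lambda>n. (norm (g n))\<^sup>2)"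
  shows "summable (\<lambda>n. B (f n) (g n))"
proof (rule summable_comparison_test')
  show "summable (\<lambda>n. (norm (f n))\<^sup>2 + (norm (g n))\<^sup>2)"
    by (intro summable_add assms)
  show "norm (B (f n) (g n)) \<le> (norm (f n))\<^sup>2 + (norm (g n))\<^sup>2" for n
  proof -
    have "2 * (norm (f n) * norm (g n)) \<le> (norm (f n))\<^sup>2 + (norm (g n))\<^sup>2"
      using zero_le_power2[of "norm (f n) - norm (g n)"] by (simp add: power2_eq_square algebra_simps)
    moreover have "0 \<le> norm (f n) * norm (g n)"
      by simp
    ultimately show ?thesis
      using assms(1)[of "f n" "g n"] by linarith
  qed
qed

text \<open>A square summable sequence in K becomes one vector of a Hilbert space. It has to be a
  type of its own, because Hilbert spaces form a type class and the projection theorem is to be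
  applied here.\<close>

typedef (overloaded) 'a ell2 = "{f :: nat \<Rightarrow> 'a::chilbert_space. summable (\<lambda>n. (norm (f n))\<^sup>2)}"
  morphisms coord Ell2
  by (rule exI[of _ "\<lambda>n. 0"]) simp

lemma square_summable_coord: "summable (\<lambda>n. (norm (coord x n))\<^sup>2)"
  using coord[of x] by simp

lemma coord_Ell2: "summable (\<lambda>n. (norm (f n))\<^sup>2) \<Longrightarrow> coord (Ell2 f) = f"
  by (simp add: Ell2_inverse)

lemma ell2_eqI: "(\<And>n. coord x n = coord y n) \<Longrightarrow> x = y"
  by (metis coord_inject ext)

lemma square_summable_scaleR:
  fixes f :: "nat \<Rightarrow> 'a::real_normed_vector"
  assumes "summable (\<lambda>n. (norm (f n))\<^sup>2)"
  shows "summable (\<lambda>n. (norm (r *\<^sub>R f n))\<^sup>2)"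
  by (rule square_summable_bounded_linear[OF bounded_linear_scaleR_right assms])

instantiation ell2 :: (chilbert_space) real_vector
begin

definition "0 = Ell2 (\<lambda>n. 0)"
definition "x + y = Ell2 (\<lambda>n. coord x n + coord y n)"
definition "- x = Ell2 (\<lambda>n. - coord x n)"
definition "x - y = Ell2 (\<lambda>n. coord x n - coord y n)"
definition "r *\<^sub>R x = Ell2 (\<lambda>n. r *\<^sub>R coord x n)"

lemma coord_zero [simp]: "coord 0 n = 0"
  by (simp add: zero_ell2_def coord_Ell2)

lemma coord_add [simp]: "coord (x + y) n = coord x n + coord y n"
  by (simp add: plus_ell2_def coord_Ell2 square_summable_add square_summable_coord)

lemma coord_uminus [simp]: "coord (- x) n = - coord x n"
  by (simp add: uminus_ell2_def coord_Ell2 square_summable_coord)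

lemma coord_diff [simp]: "coord (x - y) n = coord x n - coord y n"
  using square_summable_add[OF square_summable_coord[of x], of "\<lambda>n. - coord y n"]
  by (simp add: minus_ell2_def coord_Ell2 square_summable_coord)

lemma coord_scaleR [simp]: "coord (r *\<^sub>R x) n = r *\<^sub>R coord x n"
  using square_summable_scaleR[OF square_summable_coord[of x], of r]
  by (simp add: scaleR_ell2_def coord_Ell2)

instance
proof
  fix x y z :: "'a ell2" and r s :: real
  show "x + y + z = x + (y + z)" "x + y = y + x" "0 + x = x" "- x + x = 0" "x - y = x + - y"
    "r *\<^sub>R (x + y) = r *\<^sub>R x + r *\<^sub>R y" "(r + s) *\<^sub>R x = r *\<^sub>R x + s *\<^sub>R x"
    "r *\<^sub>R s *\<^sub>R x = (r * s) *\<^sub>R x" "1 *\<^sub>R x = x"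
    by (rule ell2_eqI, simp add: algebra_simps)+
qed

end

instantiation ell2 :: (chilbert_space) real_inner
begin

definition "inner x y = suminf (\<lambda>n. inner (coord x n) (coord y n))"
definition "norm (x :: 'a ell2) = sqrt (inner x x)"
definition "dist (x :: 'a ell2) y = norm (x - y)"
definition "sgn (x :: 'a ell2) = x /\<^sub>R norm x"
definition uniformity_ell2 :: "('a ell2 \<times> 'a ell2) filter"
  where "uniformity_ell2 = (INF e\<in>{0<..}. principal {(x, y). dist x y < e})"
definition open_ell2 :: "'a ell2 set \<Rightarrow> bool"
  where "open_ell2 U = (\<forall>x\<in>U. \<forall>\<^sub>F (x', y) in uniformity. x' = x \<longrightarrow> y \<in> U)"

lemma summable_inner_coord: "summable (\<lambda>n. inner (coord x n) (coord y n))"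
  by (rule summable_product_of_square_summable) (auto simp: square_summable_coord Cauchy_Schwarz_ineq2)

instance
proof
  fix x y z :: "'a ell2" and r :: real
  show "inner x y = inner y x"
    by (simp add: inner_ell2_def inner_commute)
  show "inner (x + y) z = inner x z + inner y z"
    by (simp add: inner_ell2_def inner_add_left suminf_add summable_inner_coord)
  show "inner (r *\<^sub>R x) y = r * inner x y"
    by (simp add: inner_ell2_def suminf_mult summable_inner_coord)
  show "0 \<le> inner x x"
    by (simp add: inner_ell2_def suminf_nonneg summable_inner_coord)
  show "inner x x = 0 \<longleftrightarrow> x = 0"
  proof
    assume "inner x x = 0"
    then have "inner (coord x n) (coord x n) = 0" for n
      using suminf_eq_zero_iff[OF summable_inner_coord[of x x]] by (simp add: inner_ell2_def)
    then show "x = 0"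
      by (intro ell2_eqI) simp
  qed (simp add: inner_ell2_def)
qed (simp_all add: norm_ell2_def dist_ell2_def sgn_ell2_def uniformity_ell2_def open_ell2_def)

end

lemma norm_ell2: "(norm x)\<^sup>2 = suminf (\<lambda>n. (norm (coord x n))\<^sup>2)"
  unfolding power2_norm_eq_inner by (simp add: inner_ell2_def)

lemma sum_norm_coord_le: "(\<Sum>n<N. (norm (coord x n))\<^sup>2) \<le> (norm x)\<^sup>2"
  unfolding norm_ell2 by (intro sum_le_suminf square_summable_coord) auto

lemma norm_coord_le: "norm (coord x n) \<le> norm x"
proof (rule power2_le_imp_le)
  have "(norm (coord x n))\<^sup>2 \<le> (\<Sum>k<Suc n. (norm (coord x k))\<^sup>2)"
    by (simp add: sum_nonneg)
  then show "(norm (coord x n))\<^sup>2 \<le> (norm x)\<^sup>2"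
    using sum_norm_coord_le order_trans by blast
qed simp

lemma norm_ell2_leI:
  assumes "\<And>N. (\<Sum>n<N. (norm (coord x n))\<^sup>2) \<le> e\<^sup>2" "e \<ge> 0"
  shows "norm x \<le> e"
proof (rule power2_le_imp_le)
  show "(norm x)\<^sup>2 \<le> e\<^sup>2"
    unfolding norm_ell2 by (intro suminf_le_const square_summable_coord assms)
qed (rule assms)

instance ell2 :: (chilbert_space) complete_space
proof
  fix f :: "nat \<Rightarrow> 'a ell2" assume f: "Cauchy f"
  have "Cauchy (\<lambda>m. coord (f m) n)" for n
  proof (rule metric_CauchyI)
    fix e :: real assume "e > 0"
    then obtain M where "\<forall>m\<ge>M. \<forall>k\<ge>M. dist (f m) (f k) < e"
      using f metric_CauchyD by blast
    moreover have "dist (coord (f m) n) (coord (f k) n) \<le> dist (f m) (f k)" for m k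
      using norm_coord_le[of "f m - f k" n] by (simp add: dist_norm)
    ultimately show "\<exists>M. \<forall>m\<ge>M. \<forall>k\<ge>M. dist (coord (f m) n) (coord (f k) n) < e"
      using le_less_trans by blast
  qed
  then have "\<forall>n. \<exists>l. (\<lambda>m. coord (f m) n) \<longlonglongrightarrow> l"
    by (simp add: Cauchy_convergent_iff convergent_def)
  then obtain l where l: "\<And>n. (\<lambda>m. coord (f m) n) \<longlonglongrightarrow> l n"
    by metis
  \<comment> \<open>Stated for finite partial sums, which pass to the coordinatewise limit; that l
    is itself square summable is deduced from this bound.\<close>
  have bound: "\<exists>M. \<forall>m\<ge>M. \<forall>N. (\<Sum>n<N. (norm (coord (f m) n - l n))\<^sup>2) \<le> e\<^sup>2" if e: "e > 0" for e
  proof -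
    obtain M where M: "\<And>m k. m \<ge> M \<Longrightarrow> k \<ge> M \<Longrightarrow> dist (f m) (f k) < e"
      using f e metric_CauchyD by blast
    have "(\<Sum>n<N. (norm (coord (f m) n - l n))\<^sup>2) \<le> e\<^sup>2" if m: "m \<ge> M" for m N
    proof (rule LIMSEQ_le_const2)
      show "(\<lambda>k. \<Sum>n<N. (norm (coord (f m) n - coord (f k) n))\<^sup>2)
          \<longlonglongrightarrow> (\<Sum>n<N. (norm (coord (f m) n - l n))\<^sup>2)"
        by (intro tendsto_intros l)
      show "\<exists>K. \<forall>k\<ge>K. (\<Sum>n<N. (norm (coord (f m) n - coord (f k) n))\<^sup>2) \<le> e\<^sup>2"
      proof (intro exI[of _ M] allI impI)
        fix k assume "k \<ge> M"
        then have "(norm (f m - f k))\<^sup>2 \<le> e\<^sup>2"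
          using M[OF m] by (intro power_mono) (auto simp: dist_norm less_imp_le)
        then show "(\<Sum>n<N. (norm (coord (f m) n - coord (f k) n))\<^sup>2) \<le> e\<^sup>2"
          using sum_norm_coord_le[of "f m - f k" N] by simp
      qed
    qed
    then show ?thesis
      by blast
  qed
  have diff: "summable (\<lambda>n. (norm (coord (f m) n - l n))\<^sup>2)"
    if "\<forall>N. (\<Sum>n<N. (norm (coord (f m) n - l n))\<^sup>2) \<le> e\<^sup>2" for m e
    using that by (intro summableI_nonneg_bounded[where x = "e\<^sup>2"]) auto
  have "summable (\<lambda>n. (norm (l n))\<^sup>2)"
  proof -
    obtain m where "\<forall>N. (\<Sum>n<N. (norm (coord (f m) n - l n))\<^sup>2) \<le> 1\<^sup>2"
      using bound[of 1] by auto
    then have "summable (\<lambda>n. (norm (l n - coord (f m) n))\<^sup>2)"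
      using diff[of m 1] by (simp add: norm_minus_commute)
    then show ?thesis
      using square_summable_add[OF _ square_summable_coord[of "f m"]] by fastforce
  qed
  then have L: "coord (Ell2 l) = l"
    by (rule coord_Ell2)
  have "f \<longlonglongrightarrow> Ell2 l"
  proof (rule metric_LIMSEQ_I)
    fix e :: real assume e: "e > 0"
    then obtain M where M: "\<And>m N. m \<ge> M \<Longrightarrow> (\<Sum>n<N. (norm (coord (f m) n - l n))\<^sup>2) \<le> (e/2)\<^sup>2"
      using bound[of "e/2"] by auto
    have "norm (f m - Ell2 l) \<le> e / 2" if "m \<ge> M" for m
      using M[OF that] e by (intro norm_ell2_leI) (simp_all add: L)
    then show "\<exists>M. \<forall>m\<ge>M. dist (f m) (Ell2 l) < e"
      using e by (intro exI[of _ M]) (fastforce simp: dist_norm)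
  qed
  then show "convergent f"
    by (auto simp: convergent_def)
qed

lemma summable_cinner_coord: "summable (\<lambda>n. cinner (coord x n) (coord y n))"
  by (rule summable_product_of_square_summable) (auto simp: square_summable_coord cmod_cinner_le)

instantiation ell2 :: (chilbert_space) chilbert_space
begin

definition "c *\<^sub>C x = Ell2 (\<lambda>n. c *\<^sub>C coord x n)"
definition "cinner x y = suminf (\<lambda>n. cinner (coord x n) (coord y n))"

lemma coord_scaleC [simp]: "coord (c *\<^sub>C x) n = c *\<^sub>C coord x n"
  by (simp add: scaleC_ell2_def coord_Ell2
      square_summable_bounded_linear[OF scaleC.bounded_linear_right] square_summable_coord)

instance
proof
  fix x y z :: "'a ell2" and c d :: complex and r :: real
  show "c *\<^sub>C (x + y) = c *\<^sub>C x + c *\<^sub>C y" "(c + d) *\<^sub>C x = c *\<^sub>C x + d *\<^sub>C x"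
    "c *\<^sub>C d *\<^sub>C x = (c * d) *\<^sub>C x" "complex_of_real r *\<^sub>C x = r *\<^sub>R x"
    by (rule ell2_eqI, simp add: scaleC_add_left scaleC_add_right scaleC_scaleC scaleC_of_real)+
  show "cinner (x + y) z = cinner x z + cinner y z"
    by (simp add: cinner_ell2_def cinner_add_left suminf_add summable_cinner_coord)
  show "cinner (c *\<^sub>C x) y = c * cinner x y"
    by (simp add: cinner_ell2_def cinner_scaleC_left suminf_mult summable_cinner_coord)
  have "(\<lambda>n. cnj (cinner (coord y n) (coord x n))) sums cnj (cinner y x)"
    using summable_sums[OF summable_cinner_coord[of y x]] by (simp add: sums_cnj cinner_ell2_def)
  then show "cinner x y = cnj (cinner y x)"
    by (simp add: cinner_ell2_def sums_iff cinner_commute[symmetric])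
  show "inner x y = Re (cinner x y)"
    by (simp add: cinner_ell2_def inner_ell2_def inner_eq_Re_cinner Re_suminf summable_cinner_coord)
qed

end

text \<open>The amplification of T to the tensor product of the sequence space with K, acting as T
  in every coordinate. The seminorms T \<mapsto> \<open>norm (ell2_map T h)\<close> define the
  ultrastrong topology.\<close>

definition ell2_map :: "('a::chilbert_space \<Rightarrow> 'a) \<Rightarrow> 'a ell2 \<Rightarrow> 'a ell2" where
  "ell2_map T x = Ell2 (\<lambda>n. T (coord x n))"

lemma coord_ell2_map [simp]: "bounded_clinear T \<Longrightarrow> coord (ell2_map T x) n = T (coord x n)"
  by (simp add: ell2_map_def coord_Ell2 square_summable_bounded_linear[OF bounded_clinearD(1)]
      square_summable_coord)

lemma bounded_clinear_ell2_map:
  assumes "bounded_clinear T"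
  shows "bounded_clinear (ell2_map T)"
proof -
  obtain K where K: "\<And>x. norm (T x) \<le> norm x * K" "K > 0"
    using bounded_linear.pos_bounded[OF bounded_clinearD(1)[OF assms]] by blast
  show ?thesis
  proof (rule bounded_clinearI)
    show "ell2_map T (x + y) = ell2_map T x + ell2_map T y" for x y
      by (rule ell2_eqI) (simp add: assms bounded_clinearD[OF assms])
    show "ell2_map T (c *\<^sub>C x) = c *\<^sub>C ell2_map T x" for c x
      by (rule ell2_eqI) (simp add: assms bounded_clinearD[OF assms])
    show "norm (ell2_map T x) \<le> norm x * K" for x
    proof (rule norm_ell2_leI)
      fix N
      have "(\<Sum>n<N. (norm (coord (ell2_map T x) n))\<^sup>2) \<le> (\<Sum>n<N. K\<^sup>2 * (norm (coord x n))\<^sup>2)"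
      proof (rule sum_mono)
        show "(norm (coord (ell2_map T x) n))\<^sup>2 \<le> K\<^sup>2 * (norm (coord x n))\<^sup>2" for n
          using power_mono[OF K(1)[of "coord x n"], of 2]
          by (simp add: assms power_mult_distrib mult.commute)
      qed
      also have "\<dots> \<le> K\<^sup>2 * (norm x)\<^sup>2"
        unfolding sum_distrib_left[symmetric] by (intro mult_left_mono sum_norm_coord_le) auto
      finally show "(\<Sum>n<N. (norm (coord (ell2_map T x) n))\<^sup>2) \<le> (norm x * K)\<^sup>2"
        by (simp add: power_mult_distrib mult.commute)
    qed (use K in auto)
  qed
qed

text \<open>The n-th coordinate embedding, adjoint to \<open>\<lambda>x. coord x n\<close>; the two
  together extract matrix entries of operators on the amplified space.\<close>

definition ell2_unit :: "nat \<Rightarrow> 'a::chilbert_space \<Rightarrow> 'a ell2" where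
  "ell2_unit n k = Ell2 (\<lambda>m. if m = n then k else 0)"

lemma coord_ell2_unit [simp]: "coord (ell2_unit n k) m = (if m = n then k else 0)"
proof -
  have "summable (\<lambda>m. (norm (if m = n then k else 0))\<^sup>2)"
    by (rule summable_finite[of "{n}"]) auto
  then show ?thesis
    by (simp add: ell2_unit_def coord_Ell2)
qed

lemma cinner_ell2_unit: "cinner x (ell2_unit n k) = cinner (coord x n) k"
proof -
  have "suminf (\<lambda>m. cinner (coord x m) (coord (ell2_unit n k) m)) = (\<Sum>m\<in>{n}. cinner (coord x m) (coord (ell2_unit n k) m))"
    by (rule suminf_finite) (auto simp: cinner.zero_right)
  then show ?thesis
    by (simp add: cinner_ell2_def)
qed

lemma norm_ell2_unit: "norm (ell2_unit n k) = norm k"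
proof -
  have "complex_of_real ((norm (ell2_unit n k))\<^sup>2) = complex_of_real ((norm k)\<^sup>2)"
    unfolding cinner_self[symmetric] cinner_ell2_unit by simp
  then have "(norm (ell2_unit n k))\<^sup>2 = (norm k)\<^sup>2"
    by (simp only: of_real_eq_iff)
  then show ?thesis
    by simp
qed

lemma bounded_clinear_ell2_unit: "bounded_clinear (ell2_unit n)"
  by (rule bounded_clinearI[where K = 1]) (auto intro!: ell2_eqI simp: norm_ell2_unit)

lemma bounded_clinear_coord: "bounded_clinear (\<lambda>x. coord x n)"
  by (rule bounded_clinearI[where K = 1]) (simp_all add: norm_coord_le)

text \<open>Alternating the terms of f and g gives one sequence whose squared seminorm is the sum of
  theirs. As h does not depend on T, the seminorms form a directed family and one vector controls
  finitely many conditions.\<close>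

lemma ell2_interleave:
  fixes f g :: "'a::chilbert_space ell2"
  shows "\<exists>h. \<forall>T. bounded_clinear T \<longrightarrow>
    norm (ell2_map T f) \<le> norm (ell2_map T h) \<and> norm (ell2_map T g) \<le> norm (ell2_map T h)"
proof -
  define k where "k n = (if even n then coord f (n div 2) else coord g ((n - 1) div 2))" for n
  have sums: "(\<lambda>n. (norm (T (k n)))\<^sup>2) sums ((norm (ell2_map T g))\<^sup>2 + (norm (ell2_map T f))\<^sup>2)"
    if T: "bounded_clinear T" for T :: "'a \<Rightarrow> 'a"
  proof -
    have *: "(\<lambda>n. (norm (T (coord x n)))\<^sup>2) sums (norm (ell2_map T x))\<^sup>2" for x
      using summable_sums[OF square_summable_coord[of "ell2_map T x"]] by (simp add: norm_ell2 T)
    have "(\<lambda>n. if even n then (norm (T (coord f (n div 2))))\<^sup>2 else (norm (T (coord g ((n - 1) div 2))))\<^sup>2)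
        sums ((norm (ell2_map T g))\<^sup>2 + (norm (ell2_map T f))\<^sup>2)"
      by (rule sums_if[OF * *])
    moreover have "(norm (T (k n)))\<^sup>2 =
        (if even n then (norm (T (coord f (n div 2))))\<^sup>2 else (norm (T (coord g ((n - 1) div 2))))\<^sup>2)" for n
      by (simp add: k_def)
    ultimately show ?thesis
      by simp
  qed
  have "summable (\<lambda>n. (norm (k n))\<^sup>2)"
    using sums[OF bounded_clinear_id] by (simp add: sums_iff)
  then have k: "coord (Ell2 k) = k"
    by (rule coord_Ell2)
  have "norm (ell2_map T f) \<le> norm (ell2_map T (Ell2 k)) \<and> norm (ell2_map T g) \<le> norm (ell2_map T (Ell2 k))"
    if "bounded_clinear T" for T
  proof -
    have "(norm (ell2_map T (Ell2 k)))\<^sup>2 = (norm (ell2_map T g))\<^sup>2 + (norm (ell2_map T f))\<^sup>2"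
      using sums[OF that] by (simp add: norm_ell2[of "ell2_map T (Ell2 k)"] that k sums_iff)
    then show ?thesis
      by (intro conjI; intro power2_le_imp_le[OF _ norm_ge_zero]) simp_all
  qed
  then show ?thesis
    by blast
qed

section \<open>Commutants\<close>

text \<open>Stated as an equivalence so that values of Q can be identified by checking membership
  and orthogonality.\<close>

lemma orthogonal_projection_exists:
  assumes "csubspace S" "closed S"
  shows "\<exists>Q. bounded_clinear Q \<and> (\<forall>x y. Q x = y \<longleftrightarrow> y \<in> S \<and> (\<forall>s\<in>S. cinner (x - y) s = 0))"
proof -
  obtain Q where Q: "\<And>x. Q x \<in> S" "\<And>x s. s \<in> S \<Longrightarrow> cinner (x - Q x) s = 0"
    using projection_exists[OF assms] by metis
  have unique: "Q x = y" if y: "y \<in> S" "\<And>s. s \<in> S \<Longrightarrow> cinner (x - y) s = 0" for x y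
  proof -
    have "Q x - y \<in> S"
      using assms Q y by (simp add: csubspace_diff)
    then have "cinner (x - y) (Q x - y) - cinner (x - Q x) (Q x - y) = 0"
      using Q y by simp
    then have "cinner (Q x - y) (Q x - y) = 0"
      by (simp add: cinner.diff_left)
    then show ?thesis
      by (simp add: cinner_self_eq_zero_iff)
  qed
  have "bounded_clinear Q"
  proof (rule bounded_clinearI)
    fix x y
    show "Q (x + y) = Q x + Q y"
    proof (rule unique)
      show "cinner (x + y - (Q x + Q y)) s = 0" if "s \<in> S" for s
        using Q(2)[OF that, of x] Q(2)[OF that, of y] by (simp add: cinner.diff_left cinner_add_left)
    qed (use assms Q in \<open>auto simp: csubspace_def\<close>)
  next
    fix c x
    show "Q (c *\<^sub>C x) = c *\<^sub>C Q x"
    proof (rule unique)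
      show "cinner (c *\<^sub>C x - c *\<^sub>C Q x) s = 0" if "s \<in> S" for s
        using Q(2)[OF that, of x] by (simp add: scaleC.diff_right[symmetric] cinner_scaleC_left)
    qed (use assms Q in \<open>auto simp: csubspace_def\<close>)
  next
    fix x
    have "cinner (x - Q x) (Q x) = 0"
      using Q by blast
    then have "cinner (Q x) (Q x) = cinner x (Q x)"
      by (simp add: cinner.diff_left)
    then have "(norm (Q x))\<^sup>2 = cmod (cinner x (Q x))"
      using cinner_self[of "Q x"] by (metis abs_of_nonneg norm_of_real zero_le_power2)
    also have "\<dots> \<le> norm x * norm (Q x)"
      by (rule cmod_cinner_le)
    finally show "norm (Q x) \<le> norm x * 1"
      by (cases "Q x = 0") (simp_all add: power2_eq_square)
  qed
  then show ?thesis
    using Q unique by blast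
qed

lemma adj_comp:
  assumes "bounded_clinear S" "bounded_clinear T"
  shows "adj (S \<circ> T) = adj T \<circ> adj S"
  by (intro adj_eqI bounded_clinear_comp bounded_clinear_adj assms)
    (simp add: cinner_adj_right assms)

lemma commutantD: "T \<in> commutant S \<Longrightarrow> bounded_clinear T"
  "T \<in> commutant S \<Longrightarrow> A \<in> S \<Longrightarrow> T (A x) = A (T x)"
  by (auto simp: commutant_def fun_eq_iff)

lemma commutantI: "bounded_clinear T \<Longrightarrow> (\<And>A x. A \<in> S \<Longrightarrow> T (A x) = A (T x)) \<Longrightarrow> T \<in> commutant S"
  by (auto simp: commutant_def fun_eq_iff)

lemma commutant_antimono: "S \<subseteq> S' \<Longrightarrow> commutant S' \<subseteq> commutant S"
  by (auto simp: commutant_def)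

lemma subset_double_commutant:
  assumes "\<And>A. A \<in> S \<Longrightarrow> bounded_clinear A"
  shows "S \<subseteq> commutant (commutant S)"
  using assms by (auto intro!: commutantI simp: commutantD)

lemma adj_in_commutant:
  assumes "\<And>A. A \<in> S \<Longrightarrow> bounded_clinear A" "\<And>A. A \<in> S \<Longrightarrow> adj A \<in> S" "T \<in> commutant S"
  shows "adj T \<in> commutant S"
proof (rule commutantI)
  note T = commutantD[OF assms(3)]
  show "bounded_clinear (adj T)"
    using T(1) by (rule bounded_clinear_adj)
  fix A x assume A: "A \<in> S"
  have "adj A \<circ> T = T \<circ> adj A"
    using T(2) A assms(2) by auto
  then have "adj (adj A \<circ> T) = adj (T \<circ> adj A)"
    by simp
  then have "adj T \<circ> A = A \<circ> adj T"
    using A T assms by (simp add: adj_comp bounded_clinear_adj adj_adj)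
  then show "adj T (A x) = A (adj T x)"
    by (simp add: fun_eq_iff)
qed

lemma unital_star_algebra_commutant:
  assumes "\<And>A. A \<in> S \<Longrightarrow> bounded_clinear A" "\<And>A. A \<in> S \<Longrightarrow> adj A \<in> S"
  shows "unital_star_algebra (commutant S)"
  unfolding unital_star_algebra_def
proof (intro conjI ballI allI)
  show "adj a \<in> commutant S" if "a \<in> commutant S" for a
    using adj_in_commutant[OF assms that] .
  show "(\<lambda>x. a x + b x) \<in> commutant S" if "a \<in> commutant S" "b \<in> commutant S" for a b
    using that by (intro commutantI bounded_clinear_add) (simp_all add: commutantD bounded_clinearD[OF assms(1)])
  show "(\<lambda>x. c *\<^sub>C a x) \<in> commutant S" if "a \<in> commutant S" for c a
    using that by (intro commutantI bounded_clinear_scaleC) (simp_all add: commutantD bounded_clinearD[OF assms(1)])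
  show "a \<circ> b \<in> commutant S" if "a \<in> commutant S" "b \<in> commutant S" for a b
    using that by (intro commutantI bounded_clinear_comp) (simp_all add: commutantD)
  show "id \<in> commutant S"
    by (intro commutantI bounded_clinear_id) simp
qed (rule commutantD)

lemma von_neumann_algebra_double_commutant:
  assumes "\<And>A. A \<in> S \<Longrightarrow> bounded_clinear A" "\<And>A. A \<in> S \<Longrightarrow> adj A \<in> S"
  shows "von_neumann_algebra (commutant (commutant S))"
  unfolding von_neumann_algebra_def
proof
  show "unital_star_algebra (commutant (commutant S))"
    by (rule unital_star_algebra_commutant) (use assms in \<open>auto simp: commutantD intro: adj_in_commutant\<close>)
  have "commutant (commutant (commutant S)) = commutant S"
    by (intro equalityI commutant_antimono subset_double_commutant) (auto simp: assms commutantD)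
  then show "commutant (commutant (commutant (commutant S))) = commutant (commutant S)"
    by simp
qed

lemma vN_generated_subset_double_commutant:
  assumes "\<And>A. A \<in> S \<Longrightarrow> bounded_clinear A" "\<And>A. A \<in> S \<Longrightarrow> adj A \<in> S"
  shows "vN_generated S \<subseteq> commutant (commutant S)"
  unfolding vN_generated_def
  by (intro Inter_lower CollectI conjI von_neumann_algebra_double_commutant subset_double_commutant assms)

lemma word_op_ell2_map:
  assumes "\<And>i. bounded_clinear (X i)"
  shows "word_op (\<lambda>i. ell2_map (X i)) w h = ell2_map (word_op X w) h"
proof (induction w)
  case Nil
  have "ell2_map id h = h"
    by (rule ell2_eqI) (simp only: coord_ell2_map[OF bounded_clinear_id] id_apply)
  then show ?case
    unfolding word_op_Nil by (simp only: id_def)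
next
  case (Cons i w)
  show ?case
    by (rule ell2_eqI)
      (simp add: Cons assms bounded_clinear_word_op coord_ell2_map[OF bounded_clinear_comp, unfolded comp_def])
qed

lemma ncpoly_op_ell2_map:
  assumes "\<And>i. bounded_clinear (X i)"
  shows "ncpoly_op (\<lambda>i. ell2_map (X i)) p h = ell2_map (ncpoly_op X p) h"
proof (rule ell2_eqI)
  fix n
  have "coord (ncpoly_op (\<lambda>i. ell2_map (X i)) p h) n = ncpoly_comb p (\<lambda>w. coord (ell2_map (word_op X w) h) n)"
    by (simp add: ncpoly_op_eq word_op_ell2_map[of X, OF assms] clinear_ncpoly_comb[OF bounded_clinear_coord])
  then show "coord (ncpoly_op (\<lambda>i. ell2_map (X i)) p h) n = coord (ell2_map (ncpoly_op X p) h) n"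
    by (simp add: ncpoly_op_eq bounded_clinear_word_op[of X, OF assms] bounded_clinear_ncpoly_op[of X, OF assms])
qed

text \<open>The double commutant theorem. The projection \<open>Q\<close> onto the closed span of the orbit of \<open>h\<close> under
  the diagonally acting polynomials has its matrix entries in the commutant, hence commutes with
  the diagonal action of \<open>a\<close>.\<close>

lemma double_commutant_approximation:
  assumes X: "\<And>i. bounded_clinear (X i)" "\<And>i. adj (X i) = X i"
    and a: "a \<in> commutant (commutant (range X))"
  shows "ell2_map a h \<in> closure (ncpoly_vectors (\<lambda>i. ell2_map (X i)) h)"
proof -
  define Z where "Z i = ell2_map (X i)" for i
  define V where "V = closure (ncpoly_vectors Z h)"
  have Z: "bounded_clinear (Z i)" for i
    unfolding Z_def by (rule bounded_clinear_ell2_map[OF X(1)])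
  have Z_sa: "cinner (Z i x) y = cinner x (Z i y)" for i x y
    by (simp add: Z_def cinner_ell2_def X(1)) (metis X cinner_adj_right)
  have V: "csubspace V" "closed V"
    unfolding V_def using csubspace_closure[OF csubspace_ncpoly_vectors[of Z, OF Z]] by auto
  have ZV: "Z i s \<in> V" if "s \<in> V" for i s
  proof -
    have "Z i ` closure (ncpoly_vectors Z h) \<subseteq> closure (Z i ` ncpoly_vectors Z h)"
      by (intro closure_bounded_linear_image_subset bounded_clinearD Z)
    also have "\<dots> \<subseteq> closure (ncpoly_vectors Z h)"
      by (intro closure_mono) (use ncpoly_vectors_mult[of Z, OF Z] in auto)
    finally show ?thesis
      using that by (auto simp: V_def)
  qed
  obtain Q where Q: "bounded_clinear Q" "\<And>x y. Q x = y \<longleftrightarrow> y \<in> V \<and> (\<forall>s\<in>V. cinner (x - y) s = 0)"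
    using orthogonal_projection_exists[OF V] by blast
  have QV: "Q x \<in> V" "s \<in> V \<Longrightarrow> cinner (x - Q x) s = 0" for x s
    using Q(2) by blast+
  have Q_sa: "cinner (Q x) y = cinner x (Q y)" for x y
    using QV(2)[OF QV(1), of x y] QV(2)[OF QV(1), of y x]
    by (simp add: cinner.diff_left) (metis cinner_commute)
  \<comment> \<open>V is invariant under the self-adjoint Z i, hence so is its orthogonal
    complement: Z i (Q x) lies in V, and Z i (x - Q x) is orthogonal to V.\<close>
  have QZ: "Q (Z i x) = Z i (Q x)" for i x
    unfolding Q(2) using QV ZV
    by (simp add: bounded_clinearD(3)[OF Z, symmetric] Z_sa)
  define E where "E m n k = coord (Q (ell2_unit n k)) m" for m n k
  have E: "E m n \<in> commutant (range X)" for m n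
  proof (rule commutantI)
    show "bounded_clinear (E m n)"
      unfolding E_def[abs_def]
      by (intro bounded_clinear_compose[OF bounded_clinear_coord]
          bounded_clinear_compose[OF Q(1)] bounded_clinear_ell2_unit)
    fix A k assume "A \<in> range X"
    then obtain i where i: "A = X i"
      by blast
    have "ell2_unit n (X i k) = Z i (ell2_unit n k)"
      by (rule ell2_eqI) (simp add: Z_def X(1) bounded_clinearD(5)[OF X(1)])
    then show "E m n (A k) = A (E m n k)"
      by (simp add: E_def i QZ) (simp add: Z_def X(1))
  qed
  have bd: "bounded_clinear A" "adj A \<in> commutant (range X)" if "A \<in> commutant (range X)" for A
    using that X adj_in_commutant[of "range X" A] by (auto simp: commutantD)
  have a': "adj a \<in> commutant (commutant (range X))"
    using adj_in_commutant[OF bd a] by blast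
  note ab = commutantD(1)[OF a] and ab' = commutantD(1)[OF a']
  \<comment> \<open>Only columns of Q are compared. In the final computation both Q and a are moved
    across the inner product onto a unit vector, which avoids infinite matrix products and is why
    \<open>adj a\<close> appears.\<close>
  have entries: "ell2_map (adj a) (Q (ell2_unit m k)) = Q (ell2_unit m (adj a k))" for m k
    using commutantD(2)[OF a' E] by (intro ell2_eqI) (simp add: ab' E_def)
  have adj_map: "cinner (ell2_map a x) y = cinner x (ell2_map (adj a) y)" for x y
    by (simp add: cinner_ell2_def ab ab' cinner_adj_right)
  have "Q (ell2_map a x) = ell2_map a (Q x)" for x
  proof (rule ell2_eqI, rule cinner_eqI)
    fix m k
    have "cinner (coord (Q (ell2_map a x)) m) k = cinner x (ell2_map (adj a) (Q (ell2_unit m k)))"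
      by (simp add: cinner_ell2_unit[symmetric] Q_sa adj_map)
    also have "\<dots> = cinner (coord (ell2_map a (Q x)) m) k"
      by (simp add: entries Q_sa[symmetric] cinner_ell2_unit ab cinner_adj_right)
    finally show "cinner (coord (Q (ell2_map a x)) m) k = cinner (coord (ell2_map a (Q x)) m) k" .
  qed
  \<comment> \<open>The empty word puts h itself into V.\<close>
  moreover have "Q h = h"
    using trace_vector_in_ncpoly_vectors[of h Z] closure_subset
    by (subst Q(2)) (auto simp: V_def cinner.zero_left)
  ultimately have "ell2_map a h \<in> V"
    by (metis QV(1))
  then show ?thesis
    by (simp add: V_def Z_def[abs_def])
qed

section \<open>Normality of the trace and density of the polynomials\<close>

text \<open>The functional given by \<xi> and \<eta>, evaluated at \<open>adj a \<circ> a\<close>,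
  is the inner product of the amplified vectors a\<xi> and a\<eta>, hence at most the square of one
  ultrastrong seminorm of a. Intersections of neighbourhoods are handled by interleaving.\<close>

lemma ultraweak_nhd_zero:
  assumes "openin ultraweak U" "(\<lambda>x. 0) \<in> U"
  shows "\<exists>h \<delta>. \<delta> > 0 \<and> (\<forall>a. bounded_clinear a \<longrightarrow> norm (ell2_map a h) < \<delta> \<longrightarrow> adj a \<circ> a \<in> U)"
  using openin_topology_generated_by[OF assms(1)[unfolded ultraweak_def]] assms(2)
proof (induction rule: generate_topology_on.induct)
  case Empty
  then show ?case
    by simp
next
  case (Int U V)
  then have "(\<lambda>x. 0) \<in> U" "(\<lambda>x. 0) \<in> V"
    by auto
  obtain h \<delta> where *: "\<delta> > 0"
    "\<And>a. bounded_clinear a \<Longrightarrow> norm (ell2_map a h) < \<delta> \<Longrightarrow> adj a \<circ> a \<in> U"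
    using Int.IH(1)[OF \<open>(\<lambda>x. 0) \<in> U\<close>] by blast
  obtain k \<epsilon> where **: "\<epsilon> > 0"
    "\<And>a. bounded_clinear a \<Longrightarrow> norm (ell2_map a k) < \<epsilon> \<Longrightarrow> adj a \<circ> a \<in> V"
    using Int.IH(2)[OF \<open>(\<lambda>x. 0) \<in> V\<close>] by blast
  obtain l where l: "\<And>a. bounded_clinear a \<Longrightarrow>
    norm (ell2_map a h) \<le> norm (ell2_map a l) \<and> norm (ell2_map a k) \<le> norm (ell2_map a l)"
    using ell2_interleave[of h k] by blast
  have "adj a \<circ> a \<in> U \<inter> V" if "bounded_clinear a" "norm (ell2_map a l) < min \<delta> \<epsilon>" for a
    using l[OF that(1)] *(2)[OF that(1)] **(2)[OF that(1)] that(2) by simp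
  moreover have "min \<delta> \<epsilon> > 0"
    using * ** by simp
  ultimately show ?case
    by blast
next
  case (UN K)
  then obtain U where "U \<in> K" "(\<lambda>x. 0) \<in> U"
    by blast
  with UN.IH show ?case
    by (meson UnionI)
next
  case (Basis U)
  then obtain \<xi> \<eta> W where U: "U = {T. bounded_clinear T \<and> suminf (\<lambda>n. cinner (T (\<xi> n)) (\<eta> n)) \<in> W}"
    and sm: "summable (\<lambda>n. (norm (\<xi> n))\<^sup>2)" "summable (\<lambda>n. (norm (\<eta> n))\<^sup>2)" and W: "open W"
    by blast
  have "0 \<in> W"
    using Basis(2) by (simp add: U cinner.zero_left)
  then obtain e where e: "e > 0" "ball 0 e \<subseteq> W"
    using W open_contains_ball by blast
  obtain h where h: "\<And>a. bounded_clinear a \<Longrightarrow>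
    norm (ell2_map a (Ell2 \<xi>)) \<le> norm (ell2_map a h) \<and> norm (ell2_map a (Ell2 \<eta>)) \<le> norm (ell2_map a h)"
    using ell2_interleave[of "Ell2 \<xi>" "Ell2 \<eta>"] by blast
  \<comment> \<open>The square root compensates for the two factors, each bounded by the same
    seminorm.\<close>
  have "adj a \<circ> a \<in> U" if a: "bounded_clinear a" "norm (ell2_map a h) < sqrt e" for a
  proof -
    have eq: "suminf (\<lambda>n. cinner ((adj a \<circ> a) (\<xi> n)) (\<eta> n)) = cinner (ell2_map a (Ell2 \<xi>)) (ell2_map a (Ell2 \<eta>))"
      by (simp add: cinner_ell2_def a(1) coord_Ell2 sm cinner_adj_left)
    have "cmod (cinner (ell2_map a (Ell2 \<xi>)) (ell2_map a (Ell2 \<eta>))) \<le>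
        norm (ell2_map a (Ell2 \<xi>)) * norm (ell2_map a (Ell2 \<eta>))"
      by (rule cmod_cinner_le)
    also have "\<dots> \<le> norm (ell2_map a h) * norm (ell2_map a h)"
      using h[OF a(1)] by (intro mult_mono) auto
    also have "\<dots> < sqrt e * sqrt e"
      using a(2) by (intro mult_strict_mono') auto
    finally have "suminf (\<lambda>n. cinner ((adj a \<circ> a) (\<xi> n)) (\<eta> n)) \<in> W"
      unfolding eq using e by (auto simp: subset_iff)
    then show ?thesis
      by (simp only: U mem_Collect_eq bounded_clinear_comp bounded_clinear_adj a(1) simp_thms)
  qed
  moreover have "sqrt e > 0"
    using e(1) by simp
  ultimately show ?case
    by blast
qed

section \<open>The GNS representation of the algebra generated by the \<open>X i\<close>\<close>

locale generated_tracial_algebra =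
  fixes M :: "('k::chilbert_space \<Rightarrow> 'k) set"
    and \<tau> :: "('k \<Rightarrow> 'k) \<Rightarrow> complex"
    and \<pi> :: "('k \<Rightarrow> 'k) \<Rightarrow> ('h::chilbert_space \<Rightarrow> 'h)"
    and \<Omega> :: 'h
    and X :: "'i \<Rightarrow> 'k \<Rightarrow> 'k"
  assumes tracial: "tracial_vN_algebra M \<tau>"
    and gns: "gns_triple M \<tau> \<pi> \<Omega>"
    and X_in: "\<And>i. X i \<in> M"
    and X_sa: "\<And>i. adj (X i) = X i"
    and generated: "M = vN_generated (range X)"
begin

lemma
  shows M_bounded: "a \<in> M \<Longrightarrow> bounded_clinear a"
    and M_id: "id \<in> M"
    and M_add: "a \<in> M \<Longrightarrow> b \<in> M \<Longrightarrow> (\<lambda>x. a x + b x) \<in> M"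
    and M_scale: "a \<in> M \<Longrightarrow> (\<lambda>x. c *\<^sub>C a x) \<in> M"
    and M_comp: "a \<in> M \<Longrightarrow> b \<in> M \<Longrightarrow> a \<circ> b \<in> M"
    and M_adj: "a \<in> M \<Longrightarrow> adj a \<in> M"
  using tracial unfolding tracial_vN_algebra_def von_neumann_algebra_def unital_star_algebra_def
  by auto

lemma
  shows \<pi>_bounded: "a \<in> M \<Longrightarrow> bounded_clinear (\<pi> a)"
    and \<pi>_id: "\<pi> id = id"
    and \<pi>_add: "a \<in> M \<Longrightarrow> b \<in> M \<Longrightarrow> \<pi> (\<lambda>x. a x + b x) = (\<lambda>\<zeta>. \<pi> a \<zeta> + \<pi> b \<zeta>)"
    and \<pi>_scale: "a \<in> M \<Longrightarrow> \<pi> (\<lambda>x. c *\<^sub>C a x) = (\<lambda>\<zeta>. c *\<^sub>C \<pi> a \<zeta>)"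
    and \<pi>_comp: "a \<in> M \<Longrightarrow> b \<in> M \<Longrightarrow> \<pi> (a \<circ> b) = \<pi> a \<circ> \<pi> b"
    and \<pi>_adj: "a \<in> M \<Longrightarrow> \<pi> (adj a) = adj (\<pi> a)"
    and \<pi>_trace: "a \<in> M \<Longrightarrow> cinner (\<pi> a \<Omega>) \<Omega> = \<tau> a"
    and \<pi>_dense: "closure ((\<lambda>a. \<pi> a \<Omega>) ` M) = UNIV"
  using gns unfolding gns_triple_def by auto

lemma
  shows trace_scale: "a \<in> M \<Longrightarrow> \<tau> (\<lambda>x. c *\<^sub>C a x) = c * \<tau> a"
    and trace_id: "\<tau> id = 1"
    and trace_comp: "a \<in> M \<Longrightarrow> b \<in> M \<Longrightarrow> \<tau> (a \<circ> b) = \<tau> (b \<circ> a)"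
    and trace_normal: "continuous_map (subtopology ultraweak M) euclidean \<tau>"
  using tracial unfolding tracial_vN_algebra_def faithful_normal_tracial_state_def by auto

lemma
  assumes "a \<in> M" "b \<in> M"
  shows M_diff: "(\<lambda>x. a x - b x) \<in> M"
    and \<pi>_diff: "\<pi> (\<lambda>x. a x - b x) = (\<lambda>\<zeta>. \<pi> a \<zeta> - \<pi> b \<zeta>)"
  using M_add[OF assms(1) M_scale[OF assms(2), of "-1"]] \<pi>_add[OF assms(1) M_scale[OF assms(2), of "-1"]]
    \<pi>_scale[OF assms(2), of "-1"]
  by (simp_all add: scaleC_minus_one)

lemma cinner_\<pi>_left: "a \<in> M \<Longrightarrow> cinner (\<pi> a x) y = cinner x (\<pi> (adj a) y)"
  by (simp add: \<pi>_adj cinner_adj_right \<pi>_bounded)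

lemma cinner_\<pi>_trace: "a \<in> M \<Longrightarrow> b \<in> M \<Longrightarrow> cinner (\<pi> a \<Omega>) (\<pi> b \<Omega>) = \<tau> (adj b \<circ> a)"
  by (simp add: \<pi>_trace[symmetric] M_comp M_adj \<pi>_comp \<pi>_adj cinner_adj_left \<pi>_bounded)

text \<open>The trace property in the form needed for the modular conjugation to be
  isometric.\<close>

lemma norm_\<pi>_adj:
  assumes "a \<in> M"
  shows "norm (\<pi> (adj a) \<Omega>) = norm (\<pi> a \<Omega>)"
proof -
  have "cinner (\<pi> (adj a) \<Omega>) (\<pi> (adj a) \<Omega>) = cinner (\<pi> a \<Omega>) (\<pi> a \<Omega>)"
    using assms by (simp add: cinner_\<pi>_trace M_adj adj_adj M_bounded trace_comp)
  then have "(norm (\<pi> (adj a) \<Omega>))\<^sup>2 = (norm (\<pi> a \<Omega>))\<^sup>2"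
    by (simp only: cinner_self of_real_eq_iff)
  then show ?thesis
    by simp
qed

text \<open>Membership in M is carried along in the induction because \<pi> is known to be
  multiplicative only on M.\<close>

lemma \<pi>_word_op: "word_op X w \<in> M \<and> \<pi> (word_op X w) = word_op (\<lambda>i. \<pi> (X i)) w"
  by (induction w) (simp_all add: M_id \<pi>_id M_comp \<pi>_comp X_in del: id_apply o_apply)

lemma zero_in_M: "(\<lambda>x. 0) \<in> M" and \<pi>_zero: "\<pi> (\<lambda>x. 0) = (\<lambda>\<zeta>. 0)" and trace_zero: "\<tau> (\<lambda>x. 0) = 0"
  using M_scale[OF M_id, of 0] \<pi>_scale[OF M_id, of 0] trace_scale[OF M_id, of 0] by simp_all

lemma \<pi>_ncpoly_op: "ncpoly_op X p \<in> M \<and> \<pi> (ncpoly_op X p) = ncpoly_op (\<lambda>i. \<pi> (X i)) p"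
proof -
  have "(\<lambda>x. \<Sum>w\<in>K. c w *\<^sub>C word_op X w x) \<in> M \<and>
    \<pi> (\<lambda>x. \<Sum>w\<in>K. c w *\<^sub>C word_op X w x) = (\<lambda>\<zeta>. \<Sum>w\<in>K. c w *\<^sub>C word_op (\<lambda>i. \<pi> (X i)) w \<zeta>)"
    if "finite K" for K c
    using that
    by (induction K) (simp_all add: zero_in_M \<pi>_zero M_add M_scale \<pi>_add \<pi>_scale \<pi>_word_op)
  then show ?thesis
    unfolding ncpoly_op_def by simp
qed

lemma norm_trace_vector: "norm \<Omega> = 1"
proof -
  have "complex_of_real ((norm \<Omega>)\<^sup>2) = complex_of_real 1"
    using \<pi>_trace[OF M_id] by (simp add: \<pi>_id trace_id cinner_self)
  then have "(norm \<Omega>)\<^sup>2 = 1\<^sup>2"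
    by (simp only: of_real_eq_iff power_one)
  then show ?thesis
    by (simp only: power2_eq_iff_nonneg[OF norm_ge_zero zero_le_one])
qed

sublocale selfadjoint_family "\<lambda>i. \<pi> (X i)" \<Omega>
  by standard (simp_all add: \<pi>_bounded X_in cinner_\<pi>_left X_sa norm_trace_vector)

lemma ncpoly_vectors_dense: "closure (ncpoly_vectors (\<lambda>i. \<pi> (X i)) \<Omega>) = UNIV"
proof -
  have "\<pi> a \<Omega> \<in> closure (ncpoly_vectors (\<lambda>i. \<pi> (X i)) \<Omega>)" if a: "a \<in> M" for a
    unfolding closure_approachable
  proof (intro allI impI)
    fix \<epsilon> :: real assume \<epsilon>: "\<epsilon> > 0"
    have "openin (subtopology ultraweak M) {T \<in> topspace (subtopology ultraweak M). \<tau> T \<in> ball 0 (\<epsilon>\<^sup>2)}"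
      using trace_normal by (rule openin_continuous_map_preimage) simp
    then obtain U where U: "openin ultraweak U"
      "{T \<in> topspace (subtopology ultraweak M). \<tau> T \<in> ball 0 (\<epsilon>\<^sup>2)} = U \<inter> M"
      unfolding openin_subtopology by blast
    \<comment> \<open>The points of the topology are those of its subbasic sets; 0 lies in the one
      given by zero sequences and the whole complex plane.\<close>
    have "(\<lambda>x. 0) \<in> topspace (ultraweak :: ('k \<Rightarrow> 'k) topology)"
      unfolding ultraweak_def topology_generated_by_topspace
      by (rule UnionI[of "{T. bounded_clinear T \<and> suminf (\<lambda>n. cinner (T ((\<lambda>n. 0) n)) ((\<lambda>n. 0) n)) \<in> UNIV}"])
        (rule CollectI, intro exI conjI, rule refl, simp_all)
    then have "(\<lambda>x. 0) \<in> {T \<in> topspace (subtopology ultraweak M). \<tau> T \<in> ball 0 (\<epsilon>\<^sup>2)}"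
      using \<epsilon> zero_in_M trace_zero by simp
    then have "(\<lambda>x. 0) \<in> U"
      unfolding U(2) by blast
    then obtain h \<delta> where h: "\<delta> > 0"
      "\<And>a. bounded_clinear a \<Longrightarrow> norm (ell2_map a h) < \<delta> \<Longrightarrow> adj a \<circ> a \<in> U"
      using ultraweak_nhd_zero[OF U(1)] by blast
    have bdd: "bounded_clinear (X i)" for i
      by (simp add: M_bounded X_in)
    have "a \<in> commutant (commutant (range X))"
      using a vN_generated_subset_double_commutant[of "range X"] generated bdd X_sa by auto
    then have "ell2_map a h \<in> closure (ncpoly_vectors (\<lambda>i. ell2_map (X i)) h)"
      by (rule double_commutant_approximation[OF bdd X_sa])
    then obtain p where p: "dist (ell2_map (ncpoly_op X p) h) (ell2_map a h) < \<delta>"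
      using h(1) unfolding closure_approachable ncpoly_vectors_def ncpoly_op_ell2_map[of X, OF bdd] by blast
    \<comment> \<open>The error is kept inside M, so that the squared length of its vector is the
      value of \<tau> at \<open>adj b \<circ> b\<close>, which normality makes smaller than the
      square of the tolerance.\<close>
    define b where "b = (\<lambda>x. ncpoly_op X p x - a x)"
    have b: "b \<in> M" "\<pi> b \<Omega> = ncpoly_op (\<lambda>i. \<pi> (X i)) p \<Omega> - \<pi> a \<Omega>"
      using a \<pi>_ncpoly_op[of p] by (simp_all add: b_def M_diff \<pi>_diff)
    have "ell2_map b h = ell2_map (ncpoly_op X p) h - ell2_map a h"
    proof (rule ell2_eqI)
      show "coord (ell2_map b h) n = coord (ell2_map (ncpoly_op X p) h - ell2_map a h) n" for n
        using a b(1) \<pi>_ncpoly_op[of p] by (simp add: M_bounded) (simp add: b_def)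
    qed
    then have "adj b \<circ> b \<in> U"
      using h(2)[of b] p b(1) by (simp add: M_bounded dist_norm)
    then have "\<tau> (adj b \<circ> b) \<in> ball 0 (\<epsilon>\<^sup>2)"
      using U(2) b(1) M_comp M_adj by blast
    then have "cmod (cinner (\<pi> b \<Omega>) (\<pi> b \<Omega>)) < \<epsilon>\<^sup>2"
      by (simp add: cinner_\<pi>_trace b(1))
    then have "(norm (\<pi> b \<Omega>))\<^sup>2 < \<epsilon>\<^sup>2"
      by (simp add: cinner_self norm_power)
    then have "dist (ncpoly_op (\<lambda>i. \<pi> (X i)) p \<Omega>) (\<pi> a \<Omega>) < \<epsilon>"
      using \<epsilon> power2_less_imp_less[of "norm (\<pi> b \<Omega>)" \<epsilon>] by (simp add: dist_norm b(2))
    then show "\<exists>y\<in>ncpoly_vectors (\<lambda>i. \<pi> (X i)) \<Omega>. dist y (\<pi> a \<Omega>) < \<epsilon>"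
      by (auto simp: ncpoly_vectors_def)
  qed
  then have "closure ((\<lambda>a. \<pi> a \<Omega>) ` M) \<subseteq> closure (ncpoly_vectors (\<lambda>i. \<pi> (X i)) \<Omega>)"
    by (intro closure_minimal) auto
  then show ?thesis
    using \<pi>_dense by blast
qed

text \<open>The vector \<open>\<eta>\<close> is the image of \<open>\<zeta>\<close> under the modular conjugation \<open>a \<Omega> \<mapsto> a\<^sup>* \<Omega>\<close>, which is
  isometric because \<open>\<tau>\<close> is a trace.\<close>

lemma conjugate_vector_exists: "\<exists>\<eta>. \<forall>a\<in>M. cinner (\<pi> a \<zeta>) \<Omega> = cinner (\<pi> a \<Omega>) \<eta>"
proof -
  have "\<zeta> \<in> closure ((\<lambda>a. \<pi> a \<Omega>) ` M)"
    using \<pi>_dense by blast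
  then obtain v where v: "\<And>n::nat. v n \<in> (\<lambda>a. \<pi> a \<Omega>) ` M" "v \<longlonglongrightarrow> \<zeta>"
    unfolding closure_sequential by blast
  then have "\<forall>n. \<exists>b. b \<in> M \<and> v n = \<pi> b \<Omega>"
    by blast
  then obtain b where b: "\<And>n. b n \<in> M" "\<And>n. v n = \<pi> (b n) \<Omega>"
    unfolding choice_iff by blast
  \<comment> \<open>The images of v n under the modular conjugation; since that is isometric on
    differences, u is Cauchy and its limit serves as \<eta>.\<close>
  define u where "u n = \<pi> (adj (b n)) \<Omega>" for n
  have dist_u: "dist (u m) (u n) = dist (v m) (v n)" for m n
  proof -
    define c where "c = (\<lambda>x. b m x - b n x)"
    have c: "c \<in> M" "\<pi> c = (\<lambda>\<zeta>. \<pi> (b m) \<zeta> - \<pi> (b n) \<zeta>)"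
      using b(1) by (simp_all add: c_def M_diff \<pi>_diff)
    have "u m - u n = \<pi> (adj c) \<Omega>"
      by (rule cinner_eqI_right)
        (simp add: cinner.diff_right u_def cinner_\<pi>_left[symmetric] b c cinner.diff_left)
    then show ?thesis
      by (simp add: dist_norm norm_\<pi>_adj c b)
  qed
  have "Cauchy v"
    using v(2) convergent_Cauchy convergent_def by blast
  then have "Cauchy u"
    by (simp add: Cauchy_def dist_u)
  then obtain \<eta> where \<eta>: "u \<longlonglongrightarrow> \<eta>"
    by (auto simp: Cauchy_convergent_iff convergent_def)
  have "cinner (\<pi> a \<zeta>) \<Omega> = cinner (\<pi> a \<Omega>) \<eta>" if a: "a \<in> M" for a
  proof (rule LIMSEQ_unique)
    show "(\<lambda>n. cinner (\<pi> a (v n)) \<Omega>) \<longlonglongrightarrow> cinner (\<pi> a \<zeta>) \<Omega>"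
      by (intro cinner.tendsto bounded_linear.tendsto[OF bounded_clinearD(1)[OF \<pi>_bounded[OF a]]]
          v(2) tendsto_const)
    \<comment> \<open>The trace property moves b n from the right of a to its left, from where it
      crosses the inner product as its adjoint.\<close>
    have "cinner (\<pi> a (v n)) \<Omega> = cinner (\<pi> a \<Omega>) (u n)" for n
    proof -
      have "cinner (\<pi> a (v n)) \<Omega> = \<tau> (a \<circ> b n)"
        using \<pi>_trace[OF M_comp[OF a b(1)]] by (simp add: b \<pi>_comp a)
      also have "\<dots> = \<tau> (b n \<circ> a)"
        using a b(1) by (rule trace_comp)
      also have "\<dots> = cinner (\<pi> (b n) (\<pi> a \<Omega>)) \<Omega>"
        using \<pi>_trace[OF M_comp[OF b(1) a]] by (simp add: b \<pi>_comp a)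
      finally show ?thesis
        by (simp add: u_def cinner_\<pi>_left b)
    qed
    then show "(\<lambda>n. cinner (\<pi> a (v n)) \<Omega>) \<longlonglongrightarrow> cinner (\<pi> a \<Omega>) \<eta>"
      by (simp add: cinner.tendsto \<eta>)
  qed
  then show ?thesis
    by blast
qed

end

text \<open>A finite sum of squared norms embedded by \<open>ennreal\<close> is never infinite,
  whatever vector the \<open>THE\<close> in \<open>conjugate_variable\<close> denotes, so finiteness
  amounts to existence.\<close>

lemma free_fisher_information_finite_iff:
  "free_fisher_information X \<Omega> < \<infinity> \<longleftrightarrow> (\<forall>j. \<exists>\<xi>. is_conjugate_variable X \<Omega> j \<xi>)"
  by (simp add: free_fisher_information_def)

theorem corollary1:
  fixes M :: "('k::chilbert_space \<Rightarrow> 'k) set"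
    and \<tau> :: "('k \<Rightarrow> 'k) \<Rightarrow> complex"
    and \<pi> :: "('k \<Rightarrow> 'k) \<Rightarrow> ('h::chilbert_space \<Rightarrow> 'h)"
    and \<Omega> :: 'h
    and X :: "'i::finite \<Rightarrow> 'k \<Rightarrow> 'k"
  assumes "tracial_vN_algebra M \<tau>"
    and "gns_triple M \<tau> \<pi> \<Omega>"
    and "\<And>i. X i \<in> M"
    and "\<And>i. adj (X i) = X i"
    and "M = vN_generated (range X)"
  shows "free_fisher_information (\<lambda>i. \<pi> (X i)) \<Omega> < \<infinity> \<longleftrightarrow>
    (\<exists>(D :: 'i \<Rightarrow> 'h set) (Y :: 'i \<Rightarrow> 'h \<Rightarrow> 'h).
       (\<forall>j. antisymmetric_op (D j) (Y j) \<and> ncpoly_vectors (\<lambda>i. \<pi> (X i)) \<Omega> \<subseteq> D j) \<and>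
       (\<forall>i j. \<forall>\<zeta>\<in>ncpoly_vectors (\<lambda>i. \<pi> (X i)) \<Omega>.
          Y j (\<pi> (X i) \<zeta>) - \<pi> (X i) (Y j \<zeta>) = (if j = i then P1 \<Omega> \<zeta> else 0)))"
proof -
  interpret generated_tracial_algebra M \<tau> \<pi> \<Omega> X
    by standard (use assms in auto)
  let ?A = "ncpoly_vectors (\<lambda>i. \<pi> (X i)) \<Omega>"
  have "(\<exists>\<xi>. is_conjugate_variable (\<lambda>i. \<pi> (X i)) \<Omega> j \<xi>) \<longleftrightarrow>
    (\<exists>D Y. antisymmetric_op D Y \<and> ?A \<subseteq> D \<and>
      (\<forall>i. \<forall>\<zeta>\<in>?A. Y (\<pi> (X i) \<zeta>) - \<pi> (X i) (Y \<zeta>) = (if j = i then P1 \<Omega> \<zeta> else 0)))"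
    (is "_ \<longleftrightarrow> (\<exists>D Y. ?R j D Y)") for j
  proof
    assume "\<exists>D Y. ?R j D Y"
    then obtain D Y where DY: "?R j D Y"
      by blast
    obtain \<eta> where "\<forall>a\<in>M. cinner (\<pi> a (Y \<Omega>)) \<Omega> = cinner (\<pi> a \<Omega>) \<eta>"
      using conjugate_vector_exists by blast
    then have "cinner (word_op (\<lambda>i. \<pi> (X i)) w (Y \<Omega>)) \<Omega> = cinner (word_op (\<lambda>i. \<pi> (X i)) w \<Omega>) \<eta>" for w
      using \<pi>_word_op[of w] by metis
    then show "\<exists>\<xi>. is_conjugate_variable (\<lambda>i. \<pi> (X i)) \<Omega> j \<xi>"
      using conjugate_variable_exists[of D Y j \<eta>] DY by blast
  qed (use antisymmetric_op_exists[OF ncpoly_vectors_dense] in blast)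
  \<comment> \<open>Regroups the conditions by j, so that \<open>choice_iff\<close> turns the
    existence of D and Y for each j into the existence of families.\<close>
  moreover have "(\<forall>j. ?R j (D j) (Y j)) \<longleftrightarrow>
    (\<forall>j. antisymmetric_op (D j) (Y j) \<and> ?A \<subseteq> D j) \<and>
    (\<forall>i j. \<forall>\<zeta>\<in>?A. Y j (\<pi> (X i) \<zeta>) - \<pi> (X i) (Y j \<zeta>) = (if j = i then P1 \<Omega> \<zeta> else 0))" for D Y
    by blast
  ultimately show ?thesis
    by (simp only: free_fisher_information_finite_iff choice_iff)
qed

end
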